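(* Let $n\ge1$ and $p>1$. Let $b$ be an effective damping, let $m$ be a mass dominated by $b$, suppose that $(b,m)$ satisfies the intrinsic accumulated-mass balance (with finite lower index $\beta\in[0,\infty)$ and some $T_0\ge 0$) and the global Liouville nonoscillation condition. Let $\rho$ be the positive slow adjoint solution described in the context, and let $f,g\in L^1(\mathbb R^n)$ satisfy $\mathcal J_0>0$, where $$\mathcal J_0:=\rho(0)\int_{\mathbb R^n}g(x)\,dx+\bigl(b(0)\rho(0)-\rho'(0)\bigr)\int_{\mathbb R^n}f(x)\,dx.$$ Put $p_{\beta,1}(n):=1+\frac{2}{n+2\beta}$ and consider, for $\varepsilon>0$, the Cauchy problem $$u_{tt}-\Delta u+b(t)u_t+m^2(t)u=|u|^p,\qquad u(0,x)=\varepsilon f(x),\quad u_t(0,x)=\varepsilon g(x).$$ Then the following statements hold. 1. If $\Omega_{\beta,T_0}$ is sublinear, i.e. $\lim_{L\to\infty}\Omega_{\beta,T_0}(L)/L=0$, then no global weak solution (weak solution on $[0,\infty)$) exists for $1<p<p_{\beta,1}(n)$. 2. At $p=p_{\beta,1}(n)$, no global weak solution exists provided $$\int_0^\infty\exp\bigl(-(p_{\beta,1}(n)-1)\,\Omega_{\beta,T_0}(L)\bigr)\,dL=\infty.$$ 3. Suppose, in addition, that for each sufficiently small $\varepsilon>0$ there exists a maximal solution $u_\varepsilon$, in a fixed local well-posedness class, on $[0,T_\varepsilon)$, and that for every $T<T_\varepsilon$ the restriction of $u_\varepsilon$ to $[0,T)$ is a weak solution on $[0,T)$. If $\Omega_{\beta,T_0}$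 is bounded, then $$1+B(T_\varepsilon)\le\begin{cases}C\left(1+\varepsilon^{-\left(\frac1{p-1}-\frac n2-\beta\right)^{-1}}\right),&1<p<p_{\beta,1}(n),\\[1ex] C\exp\bigl(C\varepsilon^{-(p-1)}\bigr),&p=p_{\beta,1}(n),\end{cases}$$ where $C>0$ may depend on the coefficients, $p$ and the fixed data, but is independent of $\varepsilon$ (here $B(\infty)=\infty$, so the bound includes $T_\varepsilon<\infty$).
   Context: Effective damping: $b\in C^2([0,\infty))$ is positive and monotone; there is $C>0$ with $|b^{(k)}(t)|\le C b(t)(1+t)^{-k}$ for $k=1,2$ and all $t\ge0$; $tb(t)\to\infty$ as $t\to\infty$; $\frac{1}{b(t)(1+t)^2}\in L^1(0,\infty)$; and $tb'(t)\le a_0 b(t)$ for all $t\ge0$ for some $a_0\in[0,1)$. Dominated mass: $m\in C^2([0,\infty))$ is positive; there is $C>0$ with $|m^{(k)}(t)|\le C m(t)(1+t)^{-k}$ for $k=1,2$ and all $t\ge0$; and $m(t)=o(b(t))$ as $t\to\infty$. Notation: for $t\ge r\ge0$, $$B(t):=\int_0^t\frac{d\tau}{b(\tau)},\quad Q(t,r):=\int_r^t\frac{m^2(\tau)}{b(\tau)}\,d\tau,\quad X(t,r):=\frac{1+B(t)}{1+B(r)}\ge1.$$ Also $[s]_+:=\max\{s,0\}$. The lower mass index is $\beta:=\liminf_{t\to\infty}B(t)m^2(t)$. Intrinsic accumulated-mass balance: $\beta\in[0,\infty)$ is finite and there exists $T_0\ge0$ such that for every $L\ge0$ $$\Omega_{\beta,T_0}(L):=\sup_{t\ge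 r\ge T_0,\ \log X(t,r)\le L}\bigl[Q(t,r)-\beta\log X(t,r)\bigr]_+<\infty.$$ Global Liouville nonoscillation condition: $m^2(t)\le\frac{b^2(t)}4+\frac{b'(t)}2$ for every $t\ge0$. Positive slow adjoint solution: under the four conditions above there exists (by a separate theorem, which may be taken as given) a solution $\rho\in C^2([0,\infty))$ of $\rho''-(b\rho)'+m^2\rho=0$ such that, for some $C>0$ and all $t\ge0$: $\rho(t)>0$; $b(t)\rho(t)-\rho'(t)>0$; $|\rho'(t)|\le Cb(t)\rho(t)$; $b(t)\rho(t)\le C(1+B(t))^\beta\exp(\Omega_{\beta,T_0}(\log(1+B(t))))$; and for some $T_*\ge T_0$ and all $t\ge T_*$: $C^{-1}b(t)^{-1}e^{Q(t,T_* )}\le\rho(t)\le C\,b(t)^{-1}e^{Q(t,T_* )}$ and $|\rho'(t)|\le\frac14 b(t)\rho(t)$. The symbol $\rho$ denotes such a fixed solution. Weak solution: let $T\in(0,\infty]$ and $f,g\in L^1(\mathbb R^n)$. A function $u\in L^p_{\mathrm{loc}}([0,T)\times\mathbb R^n)$ is a weak solution of the Cauchy problem on $[0,T)$ if for every $\phi\in C_c^2([0,T)\times\mathbb R^n)$ (support compact in $[0,T)\times\mathbb R^n$; $\phi$ need not vanish at $t=0$) $$\int_0^T\!\!\int_{\mathbb R^n}|u|^p\phi\,dx\,dt+\varepsilon\int_{\mathbb R^n}\bigl(g\phi(0)+b(0)f\phi(0)-f\phi_t(0)\bigr)dx=\int_0^T\!\!\int_{\mathbb R^n}u\bigl(\phi_{tt}-\Delta\phi-\partial_t(b\phi)+m^2\phi\bigr)dx\,dt.$$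 *)

theory Defs
  imports "HOL-Analysis.Analysis" "HOL-Library.Landau_Symbols"
begin

text \<open>Functions on \<open>[0,\<infinity>)\<close> are total functions on the reals of which only the values on \<open>{0..}\<close>
  matter; derivatives are taken within \<open>{0..}\<close>, hence one-sided at 0.\<close>

definition deriv0 :: "(real \<Rightarrow> real) \<Rightarrow> real \<Rightarrow> real" where
  "deriv0 f t = vector_derivative f (at t within {0..})"

definition C2_half_line :: "(real \<Rightarrow> real) \<Rightarrow> bool" where
  "C2_half_line f \<longleftrightarrow>
     f differentiable_on {0..} \<and> deriv0 f differentiable_on {0..} \<and>
     continuous_on {0..} (deriv0 (deriv0 f))"

definition symbol_bounds :: "(real \<Rightarrow> real) \<Rightarrow> bool" where
  "symbol_bounds f \<longleftrightarrow>
     (\<exists>C>0. \<forall>t\<ge>0. \<bar>deriv0 f t\<bar> \<le> C * f t / (1 + t) \<and>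
                    \<bar>deriv0 (deriv0 f) t\<bar> \<le> C * f t / (1 + t)\<^sup>2)"

definition effective_damping :: "(real \<Rightarrow> real) \<Rightarrow> bool" where
  "effective_damping b \<longleftrightarrow>
     C2_half_line b \<and> (\<forall>t\<ge>0. b t > 0) \<and>
     (mono_on {0..} b \<or> antimono_on {0..} b) \<and>
     symbol_bounds b \<and>
     filterlim (\<lambda>t. t * b t) at_top at_top \<and>
     set_integrable lborel {0<..} (\<lambda>t. 1 / (b t * (1 + t)\<^sup>2)) \<and>
     (\<exists>a0. 0 \<le> a0 \<and> a0 < 1 \<and> (\<forall>t\<ge>0. t * deriv0 b t \<le> a0 * b t))"

definition dominated_mass :: "(real \<Rightarrow> real) \<Rightarrow> (real \<Rightarrow> real) \<Rightarrow> bool" where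
  "dominated_mass b m \<longleftrightarrow>
     C2_half_line m \<and> (\<forall>t\<ge>0. m t > 0) \<and> symbol_bounds m \<and> m \<in> o[at_top](b)"

definition liouville_nonoscillation :: "(real \<Rightarrow> real) \<Rightarrow> (real \<Rightarrow> real) \<Rightarrow> bool" where
  "liouville_nonoscillation b m \<longleftrightarrow>
     (\<forall>t\<ge>0. (m t)\<^sup>2 \<le> (b t)\<^sup>2 / 4 + deriv0 b t / 2)"

definition B_int :: "(real \<Rightarrow> real) \<Rightarrow> real \<Rightarrow> real" where
  "B_int b t = integral {0..t} (\<lambda>s. 1 / b s)"

text \<open>Extension of \<open>B_int\<close> by the convention \<open>B(\<infinity>) = \<infinity>\<close>; only used for nonnegative arguments.\<close>

definition B_ext :: "(real \<Rightarrow> real) \<Rightarrow> ereal \<Rightarrow> ereal" where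
  "B_ext b T = (if T = \<infinity> then \<infinity> else ereal (B_int b (real_of_ereal T)))"

definition Q_int :: "(real \<Rightarrow> real) \<Rightarrow> (real \<Rightarrow> real) \<Rightarrow> real \<Rightarrow> real \<Rightarrow> real" where
  "Q_int b m t r = integral {r..t} (\<lambda>s. (m s)\<^sup>2 / b s)"

definition X_ratio :: "(real \<Rightarrow> real) \<Rightarrow> real \<Rightarrow> real \<Rightarrow> real" where
  "X_ratio b t r = (1 + B_int b t) / (1 + B_int b r)"

definition lower_mass_index :: "(real \<Rightarrow> real) \<Rightarrow> (real \<Rightarrow> real) \<Rightarrow> ereal" where
  "lower_mass_index b m = Liminf at_top (\<lambda>t. ereal (B_int b t * (m t)\<^sup>2))"

definition excess_set ::
  "(real \<Rightarrow> real) \<Rightarrow> (real \<Rightarrow> real) \<Rightarrow> real \<Rightarrow> real \<Rightarrow> real \<Rightarrow> real set" where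
  "excess_set b m \<beta> T0 L =
     {max (Q_int b m t r - \<beta> * ln (X_ratio b t r)) 0 | t r.
        T0 \<le> r \<and> r \<le> t \<and> ln (X_ratio b t r) \<le> L}"

text \<open>A real-valued supremum, meaningful only for \<open>L \<ge> 0\<close> and when the set is bounded above;
  the latter is demanded by \<open>mass_balance\<close>.\<close>

definition Omega ::
  "(real \<Rightarrow> real) \<Rightarrow> (real \<Rightarrow> real) \<Rightarrow> real \<Rightarrow> real \<Rightarrow> real \<Rightarrow> real" where
  "Omega b m \<beta> T0 L = Sup (excess_set b m \<beta> T0 L)"

definition mass_balance ::
  "(real \<Rightarrow> real) \<Rightarrow> (real \<Rightarrow> real) \<Rightarrow> real \<Rightarrow> real \<Rightarrow> bool" where
  "mass_balance b m \<beta> T0 \<longleftrightarrow>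
     lower_mass_index b m = ereal \<beta> \<and> 0 \<le> \<beta> \<and> 0 \<le> T0 \<and>
     (\<forall>L\<ge>0. bdd_above (excess_set b m \<beta> T0 L))"

definition slow_adjoint_solution ::
  "(real \<Rightarrow> real) \<Rightarrow> (real \<Rightarrow> real) \<Rightarrow> real \<Rightarrow> real \<Rightarrow> (real \<Rightarrow> real) \<Rightarrow> bool" where
  "slow_adjoint_solution b m \<beta> T0 \<rho> \<longleftrightarrow>
     C2_half_line \<rho> \<and>
     (\<forall>t\<ge>0. deriv0 (deriv0 \<rho>) t - deriv0 (\<lambda>s. b s * \<rho> s) t + (m t)\<^sup>2 * \<rho> t = 0) \<and>
     (\<exists>C>0.
        (\<forall>t\<ge>0. \<rho> t > 0 \<and> b t * \<rho> t - deriv0 \<rho> t > 0 \<and>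
               \<bar>deriv0 \<rho> t\<bar> \<le> C * b t * \<rho> t \<and>
               b t * \<rho> t \<le> C * (1 + B_int b t) powr \<beta>
                             * exp (Omega b m \<beta> T0 (ln (1 + B_int b t)))) \<and>
        (\<exists>Ts\<ge>T0. \<forall>t\<ge>Ts.
               1 / C * (1 / b t) * exp (Q_int b m t Ts) \<le> \<rho> t \<and>
               \<rho> t \<le> C * (1 / b t) * exp (Q_int b m t Ts) \<and>
               \<bar>deriv0 \<rho> t\<bar> \<le> 1 / 4 * b t * \<rho> t))"

definition J0 ::
  "(real \<Rightarrow> real) \<Rightarrow> (real \<Rightarrow> real) \<Rightarrow> (real ^ 'n \<Rightarrow> real) \<Rightarrow> (real ^ 'n \<Rightarrow> real) \<Rightarrow> real" where
  "J0 b \<rho> f g =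
     \<rho> 0 * (LINT x|lebesgue. g x) + (b 0 * \<rho> 0 - deriv0 \<rho> 0) * (LINT x|lebesgue. f x)"

definition p_crit :: "nat \<Rightarrow> real \<Rightarrow> real" where
  "p_crit n \<beta> = 1 + 2 / (real n + 2 * \<beta>)"

text \<open>The space-time region \<open>[0,T) \<times> \<real>\<^sup>n\<close>, where \<open>T\<close> may be \<open>\<infinity>\<close>.\<close>

definition slab :: "ereal \<Rightarrow> (real \<times> (real ^ 'n)) set" where
  "slab T = {z. 0 \<le> fst z \<and> ereal (fst z) < T}"

definition dir_deriv ::
  "'a::real_normed_vector set \<Rightarrow> 'a \<Rightarrow> ('a \<Rightarrow> real) \<Rightarrow> 'a \<Rightarrow> real" where
  "dir_deriv S v f z = frechet_derivative f (at z within S) v"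

definition C1_on :: "'a::euclidean_space set \<Rightarrow> ('a \<Rightarrow> real) \<Rightarrow> bool" where
  "C1_on S f \<longleftrightarrow> f differentiable_on S \<and> (\<forall>e\<in>Basis. continuous_on S (dir_deriv S e f))"

definition C2_on :: "'a::euclidean_space set \<Rightarrow> ('a \<Rightarrow> real) \<Rightarrow> bool" where
  "C2_on S f \<longleftrightarrow> C1_on S f \<and> (\<forall>e\<in>Basis. C1_on S (dir_deriv S e f))"

abbreviation time_deriv ::
  "ereal \<Rightarrow> (real \<times> (real ^ 'n) \<Rightarrow> real) \<Rightarrow> real \<times> (real ^ 'n) \<Rightarrow> real" where
  "time_deriv T \<equiv> dir_deriv (slab T) (1, 0)"

definition space_laplacian ::
  "ereal \<Rightarrow> (real \<times> (real ^ 'n) \<Rightarrow> real) \<Rightarrow> real \<times> (real ^ 'n) \<Rightarrow> real" where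
  "space_laplacian T \<phi> z =
     (\<Sum>i\<in>UNIV. dir_deriv (slab T) (0, axis i 1) (dir_deriv (slab T) (0, axis i 1) \<phi>) z)"

text \<open>Test functions vanish near \<open>t = T\<close> and for large \<open>x\<close>, but not necessarily at \<open>t = 0\<close>.\<close>

definition test_function :: "ereal \<Rightarrow> (real \<times> (real ^ 'n) \<Rightarrow> real) \<Rightarrow> bool" where
  "test_function T \<phi> \<longleftrightarrow>
     C2_on (slab T) \<phi> \<and>
     (\<exists>K. compact K \<and> K \<subseteq> slab T \<and> (\<forall>z\<in>slab T - K. \<phi> z = 0))"

definition Lp_loc :: "real \<Rightarrow> ereal \<Rightarrow> (real \<times> (real ^ 'n) \<Rightarrow> real) \<Rightarrow> bool" where
  "Lp_loc p T u \<longleftrightarrow>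
     set_borel_measurable lebesgue (slab T) u \<and>
     (\<forall>K. compact K \<and> K \<subseteq> slab T \<longrightarrow> set_integrable lebesgue K (\<lambda>z. \<bar>u z\<bar> powr p))"

definition weak_solution ::
  "(real \<Rightarrow> real) \<Rightarrow> (real \<Rightarrow> real) \<Rightarrow> (real ^ 'n \<Rightarrow> real) \<Rightarrow> (real ^ 'n \<Rightarrow> real) \<Rightarrow>
   real \<Rightarrow> real \<Rightarrow> ereal \<Rightarrow> (real \<times> (real ^ 'n) \<Rightarrow> real) \<Rightarrow> bool" where
  "weak_solution b m f g p \<epsilon> T u \<longleftrightarrow>
     0 < T \<and> Lp_loc p T u \<and>
     (\<forall>\<phi>. test_function T \<phi> \<longrightarrow>
        (LINT z:slab T|lebesgue. \<bar>u z\<bar> powr p * \<phi> z)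
        + \<epsilon> * (LINT x|lebesgue.
                 g x * \<phi> (0, x) + b 0 * f x * \<phi> (0, x) - f x * time_deriv T \<phi> (0, x))
        = (LINT z:slab T|lebesgue.
             u z * (time_deriv T (time_deriv T \<phi>) z - space_laplacian T \<phi> z
                    - time_deriv T (\<lambda>y. b (fst y) * \<phi> y) z
                    + (m (fst z))\<^sup>2 * \<phi> z)))"

abbreviation global_weak_solution ::
  "(real \<Rightarrow> real) \<Rightarrow> (real \<Rightarrow> real) \<Rightarrow> (real ^ 'n \<Rightarrow> real) \<Rightarrow> (real ^ 'n \<Rightarrow> real) \<Rightarrow>
   real \<Rightarrow> real \<Rightarrow> (real \<times> (real ^ 'n) \<Rightarrow> real) \<Rightarrow> bool" where
  "global_weak_solution b m f g p \<epsilon> u \<equiv> weak_solution b m f g p \<epsilon> \<infinity> u"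

text \<open>Here \<open>Sol T u\<close> means that \<open>u\<close> solves the Cauchy problem on \<open>[0,T)\<close> within some given
  solution class. Functions that agree almost everywhere are identified.\<close>

definition maximal_solution ::
  "(ereal \<Rightarrow> (real \<times> (real ^ 'n) \<Rightarrow> real) \<Rightarrow> bool) \<Rightarrow> ereal \<Rightarrow>
   (real \<times> (real ^ 'n) \<Rightarrow> real) \<Rightarrow> bool" where
  "maximal_solution Sol T u \<longleftrightarrow>
     0 < T \<and> Sol T u \<and>
     \<not> (\<exists>T' v. T < T' \<and> Sol T' v \<and> (AE z in lebesgue. z \<in> slab T \<longrightarrow> v z = u z))"

end

theory Submission
  imports Defs
begin

text \<open>Test the equation with \<open>\<rho>(t) H(s/R)\<close>, where \<open>s = 1 + B(t) + |x|\<^sup>2\<close> and \<open>H\<close> is a \<open>C\<^sup>2\<close> cutoff from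
  \<open>1\<close> on \<open>s \<le> R/2\<close> to \<open>0\<close> on \<open>s \<ge> R\<close>, with \<open>H'\<close> and \<open>H''\<close> dominated by \<open>H\<^sup>1\<^sup>/\<^sup>p\<close>. Since \<open>\<rho>\<close> solves the
  adjoint equation, only terms with derivatives of \<open>H\<close> survive; they live on the shell \<open>R/2 < s < R\<close>
  and are \<open>O(\<rho>/R)\<close>. Let \<open>A(R)\<close> be the \<open>\<rho>\<close>-weighted integral of \<open>|u|\<^sup>p\<close> over \<open>s < R\<close>. Young's inequality
  with a free parameter \<open>l\<close> bounds \<open>A(R/2) + \<epsilon> J\<^sub>0/2\<close> by
  \<open>l (A(R) - A(R/2)) + l\<^sup>-\<^sup>1\<^sup>/\<^sup>(\<^sup>p\<^sup>-\<^sup>1\<^sup>) G(R)\<close>, and also by a constant multiple of \<open>G(R)\<close>, where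
  \<open>G(R) = K R\<^sup>-\<^sup>\<kappa> exp(\<Omega>(log R))\<close> and \<open>\<kappa> = 1/(p-1) - n/2 - \<beta>\<close>.
  In the subcritical case \<open>\<kappa> > 0\<close> the second bound already forces \<open>\<epsilon> \<le> C G(R)\<close>. In the critical case \<open>\<kappa> = 0\<close>,
  the first bound along \<open>R = 2\<^sup>j R\<^sub>0\<close>, optimised in \<open>l\<close>, is a discrete version of
  \<open>Z' \<ge> c exp(-(p-1)\<Omega>) Z\<^sup>p\<close>, so that \<open>\<Sum>\<^sub>j exp(-(p-1)\<Omega>(log(2\<^sup>j R\<^sub>0)))\<close> is at most a multiple of
  \<open>\<epsilon>\<^sup>1\<^sup>-\<^sup>p\<close>.\<close>


section \<open>Calculus on the space-time slab\<close>

text \<open>The slab is not open, so uniqueness of derivatives within it needs an argument: from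
  each of its points one can move a little in every positive coordinate direction, because only time
  is constrained and there is room left below \<open>T\<close>.\<close>

lemma has_derivative_unique_slab:
  fixes f :: "real \<times> (real ^ 'n) \<Rightarrow> real"
  assumes z: "z \<in> slab T"
    and f: "(f has_derivative f') (at z within slab T)"
    and g: "(f has_derivative f'') (at z within slab T)"
  shows "f' = f''"
proof (rule frechet_derivative_unique_within[OF f g])
  fix i :: "real \<times> (real ^ 'n)" and e :: real
  assume i: "i \<in> Basis" and e: "0 < e"
  have t: "0 \<le> fst z" "ereal (fst z) < T" using z by (auto simp: slab_def)
  obtain r where r: "ereal (fst z) < ereal r" "ereal r < T"
    using ereal_dense2[OF t(2)] by blast
  \<comment> \<open>\<open>e/2\<close> makes the bound on the step strict; \<open>r - fst z\<close>
    keeps the time coordinate at most \<open>r\<close>, which is below \<open>T\<close>.\<close>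
  let ?d = "min (e/2) (r - fst z)"
  have d: "0 < ?d" "?d < e" using e r by auto
  have "fst i = 0 \<or> fst i = 1" using i by (auto simp: Basis_prod_def)
  then have "0 \<le> fst (z + ?d *\<^sub>R i)" "fst (z + ?d *\<^sub>R i) \<le> r"
    using d t r by (auto simp: min_def)
  then have "z + ?d *\<^sub>R i \<in> slab T"
    using r(2) by (auto simp: slab_def intro: le_less_trans[of _ "ereal r"])
  with d show "\<exists>d. 0 < \<bar>d\<bar> \<and> \<bar>d\<bar> < e \<and> z + d *\<^sub>R i \<in> slab T" 
    by (intro exI[of _ ?d]) auto
qed

text \<open>\<open>dir_deriv\<close> rests on the chosen \<open>frechet_derivative\<close>;
  uniqueness identifies it with any derivative computed by the usual rules.\<close>

lemma dir_deriv_slab: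
  fixes f :: "real \<times> (real ^ 'n) \<Rightarrow> real"
  assumes z: "z \<in> slab T" and f: "(f has_derivative f') (at z within slab T)"
  shows "dir_deriv (slab T) v f z = f' v"
proof -
  have "(f has_derivative frechet_derivative f (at z within slab T)) (at z within slab T)"
    using f by (meson differentiableI frechet_derivative_works)
  then show ?thesis
    unfolding dir_deriv_def using has_derivative_unique_slab[OF z f] by metis
qed

lemma C1_on_slabI:
  fixes f :: "real \<times> (real ^ 'n) \<Rightarrow> real"
  assumes d: "\<And>z. z \<in> slab T \<Longrightarrow> (f has_derivative f' z) (at z within slab T)"
    and c: "\<And>e. continuous_on (slab T) (\<lambda>z. f' z e)"
  shows "C1_on (slab T) f"
  unfolding C1_on_def
proof (intro conjI ballI)
  show "f differentiable_on slab T"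
    using d by (auto simp: differentiable_on_def intro: differentiableI)
  fix e :: "real \<times> (real ^ 'n)"
  show "continuous_on (slab T) (dir_deriv (slab T) e f)"
    using c[of e] by (rule continuous_on_eq) (rule dir_deriv_slab[OF _ d, symmetric])
qed

lemma slab_borel [measurable]: "(slab T :: (real \<times> (real ^ 'n)) set) \<in> sets borel"
proof -
  have "slab T = {z :: real \<times> (real ^ 'n). 0 \<le> fst z} \<inter> {z. ereal (fst z) < T}" by (auto simp: slab_def)
  moreover have "closed {z :: real \<times> (real ^ 'n). 0 \<le> fst z}"
    by (intro closed_Collect_le continuous_intros)
  moreover have "open {z :: real \<times> (real ^ 'n). ereal (fst z) < T}"
  proof (cases T)
    case (real r)
    then show ?thesis by (auto intro!: open_Collect_less continuous_intros)
  qed auto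
  ultimately show ?thesis by auto
qed

section \<open>Real-variable tools\<close>

text \<open>Away from 0 this is the power rule or the zero function. At 0 the difference quotient is
  at most \<open>\<bar>h\<bar> ^ Suc k\<close> in absolute value, which tends to 0.\<close>

lemma has_real_derivative_max_power:
  "((\<lambda>x::real. max 0 x ^ Suc (Suc k)) has_real_derivative
     real (Suc (Suc k)) * max 0 x ^ Suc k) (at x)"
proof (cases "x = 0")
  case True
  have "((\<lambda>h::real. max 0 h ^ Suc (Suc k) / h) \<longlongrightarrow> 0) (at 0)"
  proof (rule Lim_null_comparison)
    have "norm (max 0 h ^ Suc (Suc k) / h) \<le> \<bar>h\<bar> ^ Suc k" for h :: real
    proof (cases "h > 0")
      case False
      then have "max 0 h = 0" by simp
      then have "norm (max 0 h ^ Suc (Suc k) / h) = 0" by simp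
      then show ?thesis by (metis abs_ge_zero zero_le_power)
    qed (simp add: abs_mult)
    then show "\<forall>\<^sub>F h::real in at 0. norm (max 0 h ^ Suc (Suc k) / h) \<le> \<bar>h\<bar> ^ Suc k" by simp
    show "((\<lambda>h::real. \<bar>h\<bar> ^ Suc k) \<longlongrightarrow> 0) (at 0)"
      by (auto intro!: tendsto_eq_intros)
  qed
  then show ?thesis using True by (simp add: DERIV_def)
next
  case False
  show ?thesis
  proof (cases "x > 0")
    case True
    have "((\<lambda>x::real. x ^ Suc (Suc k)) has_real_derivative real (Suc (Suc k)) * max 0 x ^ Suc k) (at x)"
      using DERIV_pow[of "Suc (Suc k)" x UNIV] True by simp
    then show ?thesis
      by (rule has_field_derivative_transform_within_open[where S="{0<..}"]) (use True in auto)
  next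
    case nneg: False
    have "((\<lambda>x::real. 0) has_real_derivative real (Suc (Suc k)) * max 0 x ^ Suc k) (at x)"
      using nneg by (auto simp: max_def)
    then show ?thesis
      by (rule has_field_derivative_transform_within_open[where S="{..<0}"]) (use nneg False in auto)
  qed
qed

text \<open>Take \<open>H = y^k\<close> with \<open>y = (1 - (2s-1)_+^3)_+\<close>. The cube makes
  the junction at \<open>s = 1/2\<close> twice differentiable, and the high power leaves, after two
  derivatives, a factor \<open>y^(k-2)\<close> that is still dominated by
  \<open>H^(1/p)\<close>.\<close>

lemma cutoff_exists:
  fixes p :: real
  assumes p: "p > 1"
  obtains H H1 H2 :: "real \<Rightarrow> real" and c :: real where
    "\<And>s. (H has_real_derivative H1 s) (at s)"
    "\<And>s. (H1 has_real_derivative H2 s) (at s)"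
    "continuous_on UNIV H2"
    "\<And>s. s \<le> 1/2 \<Longrightarrow> H s = 1" "\<And>s. 1 \<le> s \<Longrightarrow> H s = 0"
    "\<And>s. 0 \<le> H s" "\<And>s. H s \<le> 1"
    "\<And>s. s \<le> 1/2 \<or> 1 \<le> s \<Longrightarrow> H1 s = 0" "\<And>s. s \<le> 1/2 \<or> 1 \<le> s \<Longrightarrow> H2 s = 0"
    "\<And>s. \<bar>H1 s\<bar> \<le> c * H s powr (1/p)" "\<And>s. \<bar>H2 s\<bar> \<le> c * H s powr (1/p)"
    "c > 0"
proof -
  \<comment> \<open>With \<open>k = j + 3\<close> this gives \<open>k \<le> (k - 2) * p\<close>,
    which is what \<open>y^(k-2) \<le> H^(1/p)\<close> needs for
    \<open>0 \<le> y \<le> 1\<close>.\<close>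
  define j where "j = nat \<lceil>2 * p / (p - 1)\<rceil>"
  have j: "real j \<ge> 2 * p / (p - 1)" unfolding j_def by linarith
  define k where "k = Suc (Suc (Suc j))"
  define v where "v s = max 0 (2 * s - 1)" for s :: real
  define y where "y s = max 0 (1 - v s ^ 3)" for s :: real
  define H where "H s = y s ^ k" for s
  define H1 where "H1 s = - 6 * real k * y s ^ (k-1) * v s ^ 2" for s
  define H2 where "H2 s = 36 * real k * real (k-1) * y s ^ (k-2) * v s ^ 4 - 24 * real k * y s ^ (k-1) * v s" for s
  have dv: "((\<lambda>s. v s ^ Suc (Suc i)) has_real_derivative real (Suc (Suc i)) * v s ^ Suc i * 2) (at s)" for i s
    unfolding v_def
    by (rule DERIV_chain2[OF has_real_derivative_max_power]) (auto intro!: derivative_eq_intros)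
  have dv3: "((\<lambda>s. 1 - v s ^ 3) has_real_derivative - (6 * v s ^ 2)) (at s)" for s
    using DERIV_diff[OF DERIV_const dv[of 1 s], of 1] by (simp add: eval_nat_numeral algebra_simps)
  have dv2: "((\<lambda>s. v s ^ 2) has_real_derivative 4 * v s) (at s)" for s
    using dv[of 0 s] by (simp add: eval_nat_numeral algebra_simps)
  have dy: "((\<lambda>s. y s ^ Suc (Suc i)) has_real_derivative real (Suc (Suc i)) * y s ^ Suc i * (- (6 * v s ^ 2))) (at s)" for i s
    unfolding y_def by (rule DERIV_chain2[OF has_real_derivative_max_power dv3])
  have d1: "(H has_real_derivative H1 s) (at s)" for s
    using dy[of "Suc j" s] unfolding H_def H1_def k_def by (simp add: algebra_simps)
  have d2: "(H1 has_real_derivative H2 s) (at s)" for s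
    using DERIV_cmult[OF DERIV_mult[OF dy[of j s] dv2[of s]], of "- 6 * real k"] 
    unfolding H1_def H2_def k_def by (simp add: algebra_simps eval_nat_numeral)
  have cv: "continuous_on UNIV v" "continuous_on UNIV y"
    unfolding v_def y_def by (auto intro!: continuous_intros)
  have v0: "v s = 0" if "s \<le> 1/2" for s using that by (auto simp: v_def)
  have vge: "v s \<ge> 0" "y s \<ge> 0" for s by (auto simp: v_def y_def)
  have v1: "v s \<le> 1" if "s \<le> 1" for s using that by (auto simp: v_def)
  have y0: "y s = 0" if "s \<ge> 1" for s
  proof -
    have "v s \<ge> 1" using that by (auto simp: v_def)
    then have "v s ^ 3 \<ge> 1" by (rule one_le_power)
    then show ?thesis by (auto simp: y_def)
  qed
  have y1: "y s \<le> 1" for s using vge(1)[of s] by (auto simp: y_def)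
  have yp: "y s ^ (k-2) \<le> H s powr (1/p)" for s
  proof (cases "y s = 0")
    case False
    then have ys: "0 < y s" using vge(2)[of s] by linarith
    have "real k / p \<le> real (k - 2)"
    proof -
      have "real j * (p - 1) \<ge> 2 * p" using j p by (simp add: field_simps)
      then have "real k \<le> real (Suc j) * p" using p unfolding k_def by (simp add: algebra_simps)
      then show ?thesis using p by (simp add: k_def field_simps)
    qed
    then have "y s powr (real (k-2)) \<le> y s powr (real k / p)"
      using ys y1[of s] by (intro powr_mono') auto
    also have "\<dots> = H s powr (1/p)"
      unfolding H_def using ys by (simp add: powr_powr flip: powr_realpow)
    finally show ?thesis using ys by (simp add: powr_realpow)
  qed (simp add: k_def)
  have yp1: "y s ^ (k-1) \<le> H s powr (1/p)" for s
    using yp[of s] power_decreasing[of "k-2" "k-1" "y s"] vge y1 by (meson diff_le_mono2 one_le_numeral order.trans)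
  let ?c = "36 * real k * real (k-1) + 24 * real k"
  have Z: "H1 s = 0" "H2 s = 0" if "s \<le> 1/2 \<or> 1 \<le> s" for s
    using that v0[of s] y0[of s] by (auto simp: H1_def H2_def k_def)
  have pos: "0 \<le> H s powr (1/p)" for s by simp
  have b1: "\<bar>H1 s\<bar> \<le> ?c * H s powr (1/p)" for s
  proof (cases "s \<le> 1")
    case True
    have "v s ^ 2 \<le> 1" using v1[OF True] vge by (simp add: power_le_one)
    then have "y s ^ (k-1) * v s ^ 2 \<le> H s powr (1/p) * 1"
      using yp1 vge pos by (intro mult_mono) auto
    then have "6 * real k * (y s ^ (k-1) * v s ^ 2) \<le> ?c * H s powr (1/p)"
      by (intro mult_mono) (use vge in \<open>auto simp: algebra_simps k_def\<close>)
    then show ?thesis using vge unfolding H1_def by (simp add: abs_mult ac_simps)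
  qed (use Z in auto)
  have b2: "\<bar>H2 s\<bar> \<le> ?c * H s powr (1/p)" for s
  proof (cases "s \<le> 1")
    case True
    have v4: "v s ^ 4 \<le> 1" using v1[OF True] vge by (simp add: power_le_one)
    have "y s ^ (k-2) * v s ^ 4 \<le> H s powr (1/p) * 1" "y s ^ (k-1) * v s \<le> H s powr (1/p) * 1"
      using yp yp1 vge pos v4 v1[OF True] by (intro mult_mono; auto)+
    then have "36 * real k * real (k-1) * (y s ^ (k-2) * v s ^ 4) \<le> 36 * real k * real (k-1) * H s powr (1/p)"
       "24 * real k * (y s ^ (k-1) * v s) \<le> 24 * real k * H s powr (1/p)"
      by (intro mult_left_mono; simp)+
    moreover have "0 \<le> 36 * real k * real (k-1) * (y s ^ (k-2) * v s ^ 4)" "0 \<le> 24 * real k * (y s ^ (k-1) * v s)"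
      using vge by simp_all
    moreover have "H2 s = 36 * real k * real (k-1) * (y s ^ (k-2) * v s ^ 4) - 24 * real k * (y s ^ (k-1) * v s)"
      unfolding H2_def by simp
    ultimately show ?thesis unfolding distrib_right by linarith
  qed (use Z in auto)
  show ?thesis
  proof (rule that[of H H1 H2 ?c])
    show "continuous_on UNIV H2" unfolding H2_def using cv by (auto intro!: continuous_intros)
    show "H s = 1" if "s \<le> 1/2" for s using v0[OF that] by (simp add: H_def y_def)
    show "H s = 0" if "1 \<le> s" for s using y0[OF that] by (simp add: H_def k_def)
    show "0 \<le> H s" "H s \<le> 1" for s unfolding H_def using vge y1 by (auto intro: power_le_one)
    show "0 < ?c" by (intro add_nonneg_pos) (auto simp: k_def)
  qed (use d1 d2 Z b1 b2 in auto)
qed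

text \<open>Either \<open>b \<le> l * a powr (p - 1)\<close> and the first term alone dominates, or
  \<open>a\<close> is below \<open>(b / l) powr (1 / (p - 1))\<close> and the second does. The
  weight \<open>l\<close> stays explicit because it is optimised later.\<close>

lemma Young_with_parameter:
  fixes a b p l :: real
  assumes p: "p > 1" and a: "0 \<le> a" and b: "0 \<le> b" and l: "0 < l"
  shows "a * b \<le> l * a powr p + l powr (- 1 / (p - 1)) * b powr (p / (p - 1))"
proof (cases "a = 0 \<or> b \<le> l * a powr (p - 1)")
  case True
  have "a * b \<le> l * a powr p"
  proof (cases "a = 0")
    case False
    then have "a * b \<le> a * (l * a powr (p - 1))" using True a by (intro mult_left_mono) auto
    also have "\<dots> = l * a powr p" using False a by (simp add: powr_diff)
    finally show ?thesis .
  qed auto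
  then show ?thesis by (smt (verit) l mult_nonneg_nonneg powr_ge_zero)
next
  case False
  then have ap: "0 < a" and lb: "l * a powr (p - 1) < b" using a by auto
  have bp: "0 < b" using lb l ap by (smt (verit) mult_pos_pos powr_gt_zero)
  have "a = (a powr (p - 1)) powr (1 / (p - 1))" using ap p by (simp add: powr_powr)
  also have "\<dots> \<le> (b / l) powr (1 / (p - 1))"
    using lb l p by (intro powr_mono2) (auto simp: field_simps)
  also have "\<dots> = l powr (- 1 / (p - 1)) * b powr (1 / (p - 1))"
    using l bp by (simp add: powr_divide powr_minus_divide)
  finally have "a * b \<le> l powr (- 1 / (p - 1)) * b powr (1 / (p - 1)) * b"
    using b by (intro mult_right_mono)
  also have "\<dots> = l powr (- 1 / (p - 1)) * (b powr (1 / (p - 1)) * b powr 1)"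
    using bp by simp
  also have "\<dots> = l powr (- 1 / (p - 1)) * b powr (p / (p - 1))"
    unfolding powr_add[symmetric] using p by (simp add: field_simps)
  finally show ?thesis by (smt (verit) l mult_nonneg_nonneg powr_ge_zero)
qed

text \<open>The mean value theorem on \<open>{s..t}\<close>, to which derivatives within
  \<open>{0..}\<close> restrict; this covers the one-sided derivative at 0.\<close>

lemma half_line_mono:
  fixes f f' :: "real \<Rightarrow> real"
  assumes d: "\<And>x. a \<le> x \<Longrightarrow> (f has_real_derivative f' x) (at x within {0..})"
    and f': "\<And>x. a \<le> x \<Longrightarrow> 0 \<le> f' x" and "0 \<le> a" "a \<le> s" "s \<le> t"
  shows "f s \<le> f t"
proof -
  have "\<exists>x\<in>{s..t}. f t - f s = f' x * (t - s)"
  proof (rule mvt_very_simple[OF \<open>s \<le> t\<close>])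
    fix x assume "s \<le> x" "x \<le> t"
    then show "(f has_derivative (*) (f' x)) (at x within {s..t})"
      using d[of x] assms(3-5) unfolding has_field_derivative_def
      by (auto intro: has_derivative_subset)
  qed
  then obtain x where x: "s \<le> x" "f t - f s = f' x * (t - s)" by auto
  have "0 \<le> f' x * (t - s)" using f'[of x] x assms by simp
  then show ?thesis using x by simp
qed

text \<open>Discrete substitute for integrating \<open>G\<^sup>p\<^sup>-\<^sup>1 Z' \<ge> c Z\<^sup>p\<close>. The interpolation hypothesis alone
  allows \<open>Z\<close> to jump by a large factor; the a priori bound \<open>a \<le> K G\<close> controls such jumps.\<close>

lemma power_deficit_step:
  fixes a b p G K :: real
  assumes p: "p > 1" and a: "0 < a" and ab: "a \<le> b" and G: "0 < G" and K: "0 < K"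
    and interp: "\<And>l. 0 < l \<Longrightarrow> a \<le> l * (b - a) + l powr (- 1 / (p - 1)) * G"
    and apriori: "a \<le> K * G"
  shows "min ((p - 1) / 4 powr p) ((1 - 2 powr (1 - p)) * K powr (1 - p)) * G powr (1 - p)
          \<le> a powr (1 - p) - b powr (1 - p)"
proof (cases "b \<le> 2 * a")
  case True
  \<comment> \<open>Makes \<open>l powr (- 1 / (p - 1)) * G\<close> equal to \<open>a / 2\<close>,
    so half of the left side is absorbed and \<open>b - a \<ge> a / (2 * l)\<close> remains.\<close>
  define l where "l = (2 * G / a) powr (p - 1)"
  have lpos: "0 < l" using G a by (simp add: l_def)
  have "l powr (- 1 / (p - 1)) = (2 * G / a) powr (-1)"
    unfolding l_def using p by (simp add: powr_powr)
  also have "\<dots> = a / (2 * G)" using G a by (simp add: powr_minus_divide)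
  finally have "a \<le> l * (b - a) + a / 2" using interp[OF lpos] G by simp
  then have ba: "a / (2 * l) \<le> b - a" using lpos by (simp add: field_simps)
  moreover have "0 < a / (2 * l)" using a lpos by simp
  ultimately have "a < b" by linarith
  \<comment> \<open>The power \<open>1 - p\<close> turns \<open>Z' \<ge> c Z^p\<close> into a linear
    decrease; \<open>z \<le> 2 * a\<close> bounds the size of its slope from below.\<close>
  have "\<exists>z. a < z \<and> z < b \<and> b powr (1 - p) - a powr (1 - p) = (b - a) * ((1 - p) * z powr (- p))"
  proof (rule MVT2[OF \<open>a < b\<close>])
    fix x assume "a \<le> x" "x \<le> b"
    then have "0 < x" using a by simp
    then show "((\<lambda>x. x powr (1 - p)) has_real_derivative (1 - p) * x powr (- p)) (at x)"
      using has_real_derivative_powr[of x "1 - p"] by simp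
  qed
  then obtain z where z: "a < z" "z < b"
    "b powr (1 - p) - a powr (1 - p) = (b - a) * ((1 - p) * z powr (- p))" by blast
  have "(2 * a) powr (- p) \<le> z powr (- p)"
    using z True a p by (intro powr_mono2') auto
  then have "a / (2 * l) * ((p - 1) * (2 * a) powr (- p)) \<le> (b - a) * ((p - 1) * z powr (- p))"
    using ba ab a lpos p by (intro mult_mono) auto
  also have "\<dots> = a powr (1 - p) - b powr (1 - p)" using z(3) by (simp add: algebra_simps)
  finally have *: "a / (2 * l) * ((p - 1) * (2 * a) powr (- p)) \<le> a powr (1 - p) - b powr (1 - p)" .
  have "a / (2 * l) * ((p - 1) * (2 * a) powr (- p)) = (p - 1) / 4 powr p * G powr (1 - p)"
  proof -
    have "(4::real) powr p = (2 * 2) powr p" by simp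
    also have "\<dots> = 2 powr p * 2 powr p" by (rule powr_mult)
    finally have 4: "(4::real) powr p = 2 powr p * 2 powr p" .
    have al: "a / (2 * l) = a powr p * G / (2 powr p * G powr p)"
      unfolding l_def using G a by (simp add: powr_divide powr_mult powr_diff field_simps)
    show ?thesis
      unfolding al using G a by (simp add: 4 powr_mult powr_minus_divide powr_diff field_simps)
  qed
  moreover have "min ((p - 1) / 4 powr p) ((1 - 2 powr (1 - p)) * K powr (1 - p)) * G powr (1 - p)
     \<le> (p - 1) / 4 powr p * G powr (1 - p)"
    by (intro mult_right_mono) auto
  ultimately show ?thesis using * by linarith
next
  case False
  have two: "(2::real) powr (1 - p) \<le> 1" using powr_mono[of "1 - p" 0 2] p by simp
  \<comment> \<open>A jump by more than a factor 2 destroys a fixed fraction of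
    \<open>a powr (1 - p)\<close>, and the a priori bound makes that quantity at least
    \<open>(K * G) powr (1 - p)\<close>.\<close>
  have "b powr (1 - p) \<le> (2 * a) powr (1 - p)"
    using False a p by (intro powr_mono2') auto
  also have "\<dots> = 2 powr (1 - p) * a powr (1 - p)" by (simp add: powr_mult)
  finally have 1: "(1 - 2 powr (1 - p)) * a powr (1 - p) \<le> a powr (1 - p) - b powr (1 - p)"
    by (simp add: algebra_simps)
  have "(K * G) powr (1 - p) \<le> a powr (1 - p)"
    using apriori a p by (intro powr_mono2') auto
  then have "K powr (1 - p) * G powr (1 - p) \<le> a powr (1 - p)"
    by (simp add: powr_mult)
  then have "(1 - 2 powr (1 - p)) * (K powr (1 - p) * G powr (1 - p)) \<le> (1 - 2 powr (1 - p)) * a powr (1 - p)"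
    using two by (intro mult_left_mono) auto
  moreover have "min ((p - 1) / 4 powr p) ((1 - 2 powr (1 - p)) * K powr (1 - p)) * G powr (1 - p)
     \<le> (1 - 2 powr (1 - p)) * K powr (1 - p) * G powr (1 - p)"
    by (intro mult_right_mono) auto
  ultimately show ?thesis using 1 by (simp add: mult.assoc)
qed

text \<open>Each index contributes a fixed multiple of \<open>G j powr (1 - p)\<close> to a
  telescoping sum of differences of \<open>Z j powr (1 - p)\<close>, whose total is at most its
  first term because powers are nonnegative. The resulting bound does not grow with
  \<open>N\<close>.\<close>

lemma sum_power_deficit:
  fixes Z G :: "nat \<Rightarrow> real"
  assumes p: "p > 1" and K: "0 < K" and z: "0 < z" "z \<le> Z 0"
    and mono: "\<And>j. j < N \<Longrightarrow> Z j \<le> Z (Suc j)"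
    and G: "\<And>j. j < N \<Longrightarrow> 0 < G j"
    and interp: "\<And>j l. j < N \<Longrightarrow> 0 < l \<Longrightarrow>
       Z j \<le> l * (Z (Suc j) - Z j) + l powr (- 1 / (p - 1)) * G j"
    and apriori: "\<And>j. j < N \<Longrightarrow> Z j \<le> K * G j"
  shows "min ((p - 1) / 4 powr p) ((1 - 2 powr (1 - p)) * K powr (1 - p)) *
           (\<Sum>j<N. G j powr (1 - p)) \<le> z powr (1 - p)"
proof -
  have pos: "0 < Z j" if "j \<le> N" for j
    using that by (induction j) (use z mono in \<open>fastforce intro: less_le_trans\<close>)+
  let ?c = "min ((p - 1) / 4 powr p) ((1 - 2 powr (1 - p)) * K powr (1 - p))"
  have "?c * (\<Sum>j<N. G j powr (1 - p)) = (\<Sum>j<N. ?c * G j powr (1 - p))"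
    by (rule sum_distrib_left)
  also have "\<dots> \<le> (\<Sum>j<N. Z j powr (1 - p) - Z (Suc j) powr (1 - p))"
    by (intro sum_mono power_deficit_step p pos mono G K interp apriori) auto
  also have "\<dots> = Z 0 powr (1 - p) - Z N powr (1 - p)"
    by (rule sum_lessThan_telescope')
  also have "\<dots> \<le> z powr (1 - p)"
  proof -
    have "Z 0 powr (1 - p) \<le> z powr (1 - p)" using z p by (intro powr_mono2') auto
    then show ?thesis by (smt (verit) powr_ge_zero)
  qed
  finally show ?thesis .
qed

text \<open>One half of the integral test: on each interval of length \<open>d\<close> an antitone
  \<open>h\<close> is at most its value at the left end, and \<open>h 0\<close> covers
  \<open>{0..L0}\<close>. An arithmetic progression in \<open>L\<close> is a dyadic one in
  \<open>R = exp L\<close> when \<open>d = ln 2\<close>.\<close>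

lemma nn_integral_less_top_of_dyadic_sum:
  fixes h :: "real \<Rightarrow> real"
  assumes mono: "\<And>x y. 0 \<le> x \<Longrightarrow> x \<le> y \<Longrightarrow> h y \<le> h x" and h: "\<And>x. 0 \<le> x \<Longrightarrow> 0 \<le> h x"
    and L0: "0 \<le> L0" and d: "0 < d"
    and sum: "\<And>N :: nat. (\<Sum>i<N. h (L0 + real i * d)) \<le> s"
  shows "(\<integral>\<^sup>+ x \<in> {0..}. ennreal (h x) \<partial>lborel) < \<infinity>"
proof -
  let ?I = "\<lambda>i :: nat. {L0 + real i * d..<L0 + real (Suc i) * d}"
  have bound: "ennreal (h x) * indicator {0..} x
      \<le> ennreal (h 0) * indicator {0..L0} x + (\<Sum>i. ennreal (h (L0 + real i * d)) * indicator (?I i) x)" for x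
  proof (cases "0 \<le> x \<and> x \<le> L0")
    case True
    then have "ennreal (h x) * indicator {0..} x \<le> ennreal (h 0) * indicator {0..L0} x"
      by (simp add: ennreal_leI mono)
    then show ?thesis by (rule order_trans) simp
  next
    case False
    show ?thesis
    proof (cases "0 \<le> x")
      case True
      define i where "i = nat \<lfloor>(x - L0) / d\<rfloor>"
      have x: "L0 < x" using True False by simp
      then have "real i = of_int \<lfloor>(x - L0) / d\<rfloor>" using d by (simp add: i_def)
      then have "real i \<le> (x - L0) / d" "(x - L0) / d < real i + 1" by linarith+
      then have i: "x \<in> ?I i" using d by (simp add: field_simps)
      then have "h x \<le> h (L0 + real i * d)" using d L0 by (intro mono) auto
      then have "ennreal (h x) * indicator {0..} x \<le> (\<Sum>j\<in>{i}. ennreal (h (L0 + real j * d)) * indicator (?I j) x)"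
        using i True by (simp add: ennreal_leI)
      also have "\<dots> \<le> (\<Sum>j. ennreal (h (L0 + real j * d)) * indicator (?I j) x)"
        by (rule sum_le_suminf) auto
      finally show ?thesis by (rule order_trans) simp
    qed simp
  qed
  have tail: "(\<Sum>i. ennreal (h (L0 + real i * d)) * ennreal d) \<le> ennreal (s * d)"
  proof (rule suminf_le_const)
    fix N
    have "(\<Sum>i<N. ennreal (h (L0 + real i * d)) * ennreal d) = ennreal ((\<Sum>i<N. h (L0 + real i * d)) * d)"
      using h L0 d by (simp add: sum_distrib_right sum_ennreal flip: ennreal_mult')
    also have "\<dots> \<le> ennreal (s * d)" using sum[of N] d by (intro ennreal_leI mult_right_mono) auto
    finally show "(\<Sum>i<N. ennreal (h (L0 + real i * d)) * ennreal d) \<le> ennreal (s * d)" .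
  qed simp
  have "(\<integral>\<^sup>+ x \<in> {0..}. ennreal (h x) \<partial>lborel)
     \<le> (\<integral>\<^sup>+ x. ennreal (h 0) * indicator {0..L0} x + (\<Sum>i. ennreal (h (L0 + real i * d)) * indicator (?I i) x) \<partial>lborel)"
    by (intro nn_integral_mono bound)
  also have "\<dots> = ennreal (h 0) * ennreal L0 + (\<Sum>i. ennreal (h (L0 + real i * d)) * ennreal d)"
    using L0 d by (simp add: nn_integral_add nn_integral_suminf nn_integral_cmult_indicator algebra_simps)
  also have "\<dots> \<le> ennreal (h 0) * ennreal L0 + ennreal (s * d)"
    by (rule add_left_mono[OF tail])
  also have "\<dots> < \<infinity>"
    by (simp add: ennreal_mult_less_top)
  finally show ?thesis .
qed

section \<open>The weak inequality for a slow adjoint weight\<close>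

text \<open>Derivatives enter as explicit functions, so that the calculus runs on one-sided
  derivative rules; one constant \<open>C\<close> serves all three coefficient bounds. The last of
  them makes \<open>1 / (R * b)^2\<close> of order \<open>1 / R\<close> where
  \<open>1 + B \<le> R\<close>.\<close>

locale liouville_cutoff =
  fixes p :: real and H H1 H2 :: "real \<Rightarrow> real" and c\<^sub>H :: real
    and b b' \<rho> \<rho>' \<rho>'' m B :: "real \<Rightarrow> real" and C :: real
  assumes p: "p > 1"
    and H_deriv: "\<And>s. (H has_real_derivative H1 s) (at s)"
    and H1_deriv: "\<And>s. (H1 has_real_derivative H2 s) (at s)"
    and H2_cont: "continuous_on UNIV H2"
    and H_eq_1: "\<And>s. s \<le> 1/2 \<Longrightarrow> H s = 1"
    and H_eq_0: "\<And>s. 1 \<le> s \<Longrightarrow> H s = 0"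
    and H_ge_0: "\<And>s. 0 \<le> H s"
    and H_le_1: "\<And>s. H s \<le> 1"
    and H1_eq_0: "\<And>s. s \<le> 1/2 \<or> 1 \<le> s \<Longrightarrow> H1 s = 0"
    and H2_eq_0: "\<And>s. s \<le> 1/2 \<or> 1 \<le> s \<Longrightarrow> H2 s = 0"
    and H1_bound: "\<And>s. \<bar>H1 s\<bar> \<le> c\<^sub>H * H s powr (1/p)"
    and H2_bound: "\<And>s. \<bar>H2 s\<bar> \<le> c\<^sub>H * H s powr (1/p)"
    and cH_pos: "c\<^sub>H > 0"
    and b_deriv: "\<And>t. 0 \<le> t \<Longrightarrow> (b has_real_derivative b' t) (at t within {0..})"
    and b'_cont: "continuous_on {0..} b'"
    and b_pos: "\<And>t. 0 \<le> t \<Longrightarrow> 0 < b t"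
    and rho_deriv: "\<And>t. 0 \<le> t \<Longrightarrow> (\<rho> has_real_derivative \<rho>' t) (at t within {0..})"
    and rho'_deriv: "\<And>t. 0 \<le> t \<Longrightarrow> (\<rho>' has_real_derivative \<rho>'' t) (at t within {0..})"
    and rho''_cont: "continuous_on {0..} \<rho>''"
    and rho_pos: "\<And>t. 0 \<le> t \<Longrightarrow> 0 < \<rho> t"
    and adjoint: "\<And>t. 0 \<le> t \<Longrightarrow> \<rho>'' t - (b' t * \<rho> t + b t * \<rho>' t) + (m t)\<^sup>2 * \<rho> t = 0"
    and B_deriv: "\<And>t. 0 \<le> t \<Longrightarrow> (B has_real_derivative 1 / b t) (at t within {0..})"
    and B_0: "B 0 = 0"
    and C_pos: "C > 0"
    and rho'_bound: "\<And>t. 0 \<le> t \<Longrightarrow> \<bar>\<rho>' t\<bar> \<le> C * b t * \<rho> t"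
    and b'_bound: "\<And>t. 0 \<le> t \<Longrightarrow> \<bar>b' t\<bar> \<le> C * (b t)\<^sup>2"
    and b_inverse_bound: "\<And>t. 0 \<le> t \<Longrightarrow> 1 / (b t)\<^sup>2 \<le> C * (1 + B t)"
begin

lemma coeff_continuous:
  "continuous_on {0..} b" "continuous_on {0..} \<rho>" "continuous_on {0..} \<rho>'" "continuous_on {0..} B"
  "continuous_on UNIV H" "continuous_on UNIV H1"
  using b_deriv rho_deriv rho'_deriv B_deriv H_deriv H1_deriv
  by (meson DERIV_continuous_on atLeast_iff DERIV_isCont continuous_at_imp_continuous_on)+

section \<open>Parabolic scale and derivatives of the weighted cutoff\<close>

definition par_scale :: "real \<Rightarrow> real \<times> (real ^ 'n) \<Rightarrow> real" where
  "par_scale R z = (1 + B (fst z) + snd z \<bullet> snd z) / R"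

definition test_fun :: "real \<Rightarrow> real \<times> (real ^ 'n) \<Rightarrow> real" where
  "test_fun R z = \<rho> (fst z) * H (par_scale R z)"

text \<open>Building blocks made of a time coefficient, an affine function of \<open>x\<close> and a
  profile of the scale. The test function is one of them and its directional derivatives are sums of
  them, so one differentiation rule serves both orders.\<close>

definition product_term where
  "product_term R a c l K (z :: real \<times> (real ^ 'n)) = a (fst z) * (c + snd z \<bullet> l) * K (par_scale R z)"

definition product_term_deriv where
  "product_term_deriv R a a' c l K K' (z :: real \<times> (real ^ 'n)) w =
     a' (fst z) * fst w * (c + snd z \<bullet> l) * K (par_scale R z) + a (fst z) * (snd w \<bullet> l) * K (par_scale R z)
     + a (fst z) * (c + snd z \<bullet> l) * (K' (par_scale R z) * (fst w / (R * b (fst z)) + 2 * (snd z \<bullet> snd w) / R))"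

lemma fst_slab: "z \<in> slab T \<Longrightarrow> 0 \<le> fst z"
  by (simp add: slab_def)

lemma has_derivative_fst_slab:
  fixes z :: "real \<times> (real ^ 'n)"
  assumes "z \<in> slab T" and "(a has_real_derivative a') (at (fst z) within {0..})"
  shows "((\<lambda>z. a (fst z)) has_derivative (\<lambda>w. a' * fst w)) (at z within slab T)"
proof -
  have "(a has_derivative (*) a') (at (fst z) within {0..})"
    using assms(2) by (simp add: has_field_derivative_def)
  moreover have "fst ` slab T \<subseteq> {0..}" by (auto simp: slab_def)
  ultimately have "(a has_derivative (*) a') (at (fst z) within fst ` slab T)"
    by (rule has_derivative_subset)
  from has_derivative_in_compose[OF has_derivative_fst[OF has_derivative_ident] this]
  show ?thesis by simp
qed

lemma par_scale_has_derivative: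
  fixes z :: "real \<times> (real ^ 'n)"
  assumes "z \<in> slab T"
  shows "(par_scale R has_derivative (\<lambda>w. fst w / (R * b (fst z)) + 2 * (snd z \<bullet> snd w) / R)) (at z within slab T)"
proof -
  have "((\<lambda>z. B (fst z)) has_derivative (\<lambda>w. 1 / b (fst z) * fst w)) (at z within slab T)"
    using assms by (intro has_derivative_fst_slab B_deriv fst_slab)
  moreover have "((\<lambda>z. snd z \<bullet> snd z) has_derivative (\<lambda>w. snd z \<bullet> snd w + snd w \<bullet> snd z)) (at z within slab T)"
    by (intro derivative_intros)
  ultimately have "((\<lambda>z. (B (fst z) + snd z \<bullet> snd z) + 1) has_derivative
      (\<lambda>w. 1 / b (fst z) * fst w + (snd z \<bullet> snd w + snd w \<bullet> snd z))) (at z within slab T)"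
    by (intro has_derivative_add_const has_derivative_add)
  from has_derivative_scaleR_right[OF this, of "1 / R"] show ?thesis
    unfolding par_scale_def by (rule has_derivative_eq_rhs[THEN has_derivative_transform[OF assms, rotated]])
       (auto simp: inner_commute algebra_simps add_divide_distrib fun_eq_iff)
qed

lemma product_term_has_derivative:
  fixes z :: "real \<times> (real ^ 'n)"
  assumes z: "z \<in> slab T" and a: "(a has_real_derivative a' (fst z)) (at (fst z) within {0..})"
    and K: "(K has_real_derivative K' (par_scale R z)) (at (par_scale R z))"
  shows "(product_term R a c l K has_derivative product_term_deriv R a a' c l K K' z) (at z within slab T)"
proof -
  have 1: "((\<lambda>z. a (fst z)) has_derivative (\<lambda>w. a' (fst z) * fst w)) (at z within slab T)"
    by (rule has_derivative_fst_slab[OF z a])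
  have 2: "((\<lambda>z. c + snd z \<bullet> l) has_derivative (\<lambda>w. snd w \<bullet> l)) (at z within slab T)"
    by (auto intro!: derivative_eq_intros)
  have "(K has_derivative (*) (K' (par_scale R z))) (at (par_scale R z))"
    using K by (simp add: has_field_derivative_def)
  from has_derivative_compose[OF par_scale_has_derivative[OF z] this]
  have 3: "((\<lambda>z. K (par_scale R z)) has_derivative
    (\<lambda>w. K' (par_scale R z) * (fst w / (R * b (fst z)) + 2 * (snd z \<bullet> snd w) / R))) (at z within slab T)" .
  from has_derivative_mult[OF has_derivative_mult[OF 1 2] 3]
  show ?thesis unfolding product_term_def[abs_def] product_term_deriv_def[abs_def]
    by (rule has_derivative_eq_rhs) (auto simp: fun_eq_iff algebra_simps)
qed

lemma par_scale_continuous: "continuous_on (slab T) (par_scale R :: real \<times> (real ^ 'n) \<Rightarrow> real)"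
  by (rule has_derivative_continuous_on) (erule par_scale_has_derivative)

lemma continuous_on_fst_slab:
  assumes "continuous_on {0..} a"
  shows "continuous_on (slab T) (\<lambda>z :: real \<times> (real ^ 'n). a (fst z))"
  by (rule continuous_on_compose2[OF assms continuous_on_fst[OF continuous_on_id]]) (auto simp: slab_def)

lemma product_term_deriv_continuous:
  assumes "R > 0" "continuous_on {0..} a" "continuous_on {0..} a'" "continuous_on UNIV K" "continuous_on UNIV K'"
  shows "continuous_on (slab T) (\<lambda>z :: real \<times> (real ^ 'n). product_term_deriv R a a' c l K K' z w)"
proof -
  have K: "continuous_on (slab T) (\<lambda>z :: real \<times> (real ^ 'n). K (par_scale R z))"
          "continuous_on (slab T) (\<lambda>z :: real \<times> (real ^ 'n). K' (par_scale R z))"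
    using assms by (auto intro: continuous_on_compose2[OF _ par_scale_continuous])
  have b: "\<And>z :: real \<times> (real ^ 'n). z \<in> slab T \<Longrightarrow> R * b (fst z) \<noteq> 0"
    using assms(1) b_pos[OF fst_slab] by (metis less_irrefl mult_pos_pos)
  show ?thesis
    unfolding product_term_deriv_def
    by (intro continuous_intros K continuous_on_fst_slab assms coeff_continuous) (use b assms(1) in auto)
qed

text \<open>Derivative of \<open>test_fun R\<close> along \<open>v\<close>, read as a function of
  \<open>z\<close> for fixed \<open>v\<close>: the components of \<open>v\<close> enter as the
  constants \<open>c\<close> and \<open>l\<close> of the building blocks, which lets the same rule
  differentiate it again.\<close>

definition test_fun_deriv :: "real \<Rightarrow> real \<times> (real ^ 'n) \<Rightarrow> real \<times> (real ^ 'n) \<Rightarrow> real" where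
  "test_fun_deriv R v z = product_term R \<rho>' (fst v) 0 H z + product_term R (\<lambda>t. \<rho> t / (R * b t)) (fst v) 0 H1 z
     + product_term R (\<lambda>t. 2 / R * \<rho> t) 0 (snd v) H1 z"

definition test_fun_deriv2 :: "real \<Rightarrow> real \<times> (real ^ 'n) \<Rightarrow> real \<times> (real ^ 'n) \<Rightarrow> real \<times> (real ^ 'n) \<Rightarrow> real" where
  "test_fun_deriv2 R v w z = product_term_deriv R \<rho>' \<rho>'' (fst v) 0 H H1 z w
     + product_term_deriv R (\<lambda>t. \<rho> t / (R * b t)) (\<lambda>t. (\<rho>' t / b t - \<rho> t * b' t / (b t)\<^sup>2) / R) (fst v) 0 H1 H2 z w
     + product_term_deriv R (\<lambda>t. 2 / R * \<rho> t) (\<lambda>t. 2 / R * \<rho>' t) 0 (snd v) H1 H2 z w"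

lemma test_fun_has_derivative:
  fixes z :: "real \<times> (real ^ 'n)"
  assumes z: "z \<in> slab T"
  shows "(test_fun R has_derivative (\<lambda>w. test_fun_deriv R w z)) (at z within slab T)"
proof -
  have "(product_term R \<rho> 1 0 H has_derivative product_term_deriv R \<rho> \<rho>' 1 0 H H1 z) (at z within slab T)"
    by (intro product_term_has_derivative z rho_deriv fst_slab[OF z] H_deriv)
  moreover have "product_term R \<rho> 1 0 H = (test_fun R :: real \<times> (real ^ 'n) \<Rightarrow> real)"
    by (auto simp: product_term_def test_fun_def)
  ultimately show ?thesis
    by (rule_tac has_derivative_eq_rhs)
       (auto simp: test_fun_deriv_def product_term_def product_term_deriv_def fun_eq_iff algebra_simps)
qed

lemma test_fun_deriv_has_derivative:
  fixes z v :: "real \<times> (real ^ 'n)"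
  assumes z: "z \<in> slab T" and R: "R > 0"
  shows "(test_fun_deriv R v has_derivative (\<lambda>w. test_fun_deriv2 R v w z)) (at z within slab T)"
proof -
  have t: "0 \<le> fst z" "b (fst z) \<noteq> 0" using fst_slab[OF z] b_pos[of "fst z"] by auto
  have "((\<lambda>t. \<rho> t / (R * b t)) has_real_derivative
    (\<rho>' (fst z) / b (fst z) - \<rho> (fst z) * b' (fst z) / (b (fst z))\<^sup>2) / R) (at (fst z) within {0..})"
    using t R by (auto intro!: derivative_eq_intros rho_deriv b_deriv simp: field_simps power2_eq_square)
  moreover have "((\<lambda>t. 2 / R * \<rho> t) has_real_derivative 2 / R * \<rho>' (fst z)) (at (fst z) within {0..})"
    by (intro DERIV_cmult rho_deriv t)
  ultimately show ?thesis
    unfolding test_fun_deriv_def[abs_def] test_fun_deriv2_def[abs_def]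
    by (intro has_derivative_add product_term_has_derivative z H_deriv H1_deriv rho'_deriv t)
qed

lemma test_fun_deriv2_continuous:
  fixes v w :: "real \<times> (real ^ 'n)"
  assumes R: "R > 0"
  shows "continuous_on (slab T) (test_fun_deriv2 R v w)"
proof -
  have b: "\<And>t. 0 \<le> t \<Longrightarrow> b t \<noteq> 0" using b_pos by fastforce
  show ?thesis
    unfolding test_fun_deriv2_def
    by (intro continuous_on_add product_term_deriv_continuous continuous_intros coeff_continuous b'_cont rho''_cont H2_cont R)
       (use b R in auto)
qed

lemma dir_deriv_test_fun:
  fixes z v :: "real \<times> (real ^ 'n)"
  shows "z \<in> slab T \<Longrightarrow> dir_deriv (slab T) v (test_fun R) z = test_fun_deriv R v z"
  by (rule dir_deriv_slab[OF _ test_fun_has_derivative])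

lemma dir_deriv_test_fun_has_derivative:
  fixes z v :: "real \<times> (real ^ 'n)"
  assumes z: "z \<in> slab T" and R: "R > 0"
  shows "(dir_deriv (slab T) v (test_fun R) has_derivative (\<lambda>w. test_fun_deriv2 R v w z)) (at z within slab T)"
  by (rule has_derivative_transform[OF z dir_deriv_test_fun test_fun_deriv_has_derivative[OF z R]])

lemma C2_on_test_fun:
  assumes R: "R > 0"
  shows "C2_on (slab T) (test_fun R :: real \<times> (real ^ 'n) \<Rightarrow> real)"
  unfolding C2_on_def
proof (intro conjI ballI)
  have "continuous_on (slab T) (test_fun_deriv R v)" for v :: "real \<times> (real ^ 'n)"
    by (rule has_derivative_continuous_on) (rule test_fun_deriv_has_derivative[OF _ R])
  then show "C1_on (slab T) (test_fun R :: real \<times> (real ^ 'n) \<Rightarrow> real)"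
    by (intro C1_on_slabI[OF test_fun_has_derivative])
  show "C1_on (slab T) (dir_deriv (slab T) v (test_fun R))" for v :: "real \<times> (real ^ 'n)"
    by (rule C1_on_slabI[OF dir_deriv_test_fun_has_derivative[OF _ R]], assumption) (rule test_fun_deriv2_continuous[OF R])
qed

section \<open>Compact support of the test function\<close>

lemma B_le: "0 \<le> s \<Longrightarrow> s \<le> t \<Longrightarrow> B s \<le> B t"
  by (rule half_line_mono[where f = B and a = 0, OF B_deriv]) (use b_pos in \<open>auto intro: less_imp_le\<close>)

lemma B_nonneg: "0 \<le> t \<Longrightarrow> 0 \<le> B t"
  using B_le[of 0 t] B_0 by simp

text \<open>The nonnegative summands of \<open>1 + B + |x|^2 < R\<close> are controlled separately:
  \<open>|x|^2 \<le> R\<close>, and \<open>B (fst z) < B t1\<close> forces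
  \<open>fst z \<le> t1\<close> by monotonicity.\<close>

lemma par_scale_less_1:
  assumes z: "z \<in> slab T" and "R > 0" "0 \<le> t1" "R \<le> 1 + B t1" "par_scale R z < 1"
  shows "z \<in> {0..t1} \<times> cball 0 (sqrt R)"
proof -
  have s: "1 + B (fst z) + snd z \<bullet> snd z < R"
    using assms by (simp add: par_scale_def)
  have "snd z \<bullet> snd z \<le> R" using s B_nonneg[OF fst_slab[OF z]] by linarith
  then have "norm (snd z) \<le> sqrt R" by (simp add: norm_eq_sqrt_inner)
  moreover have "B (fst z) < B t1" using s assms(4) inner_ge_zero[of "snd z"] by linarith
  then have "fst z \<le> t1" using B_le[of t1 "fst z"] assms(3) by linarith
  ultimately show ?thesis
    using fst_slab[OF z] by (auto simp: mem_Times_iff)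
qed

lemma test_function_test_fun:
  assumes "R > 0" "0 \<le> t1" "ereal t1 < T" "R \<le> 1 + B t1"
  shows "test_function T (test_fun R :: real \<times> (real ^ 'n) \<Rightarrow> real)"
  unfolding test_function_def
proof (intro conjI exI)
  show "C2_on (slab T) (test_fun R :: real \<times> (real ^ 'n) \<Rightarrow> real)" by (rule C2_on_test_fun[OF assms(1)])
  let ?K = "{0..t1} \<times> cball (0 :: real ^ 'n) (sqrt R)"
  show "compact ?K" by (intro compact_Times) auto
  show "?K \<subseteq> slab T" using assms(3) by (auto simp: slab_def intro: le_less_trans[of _ "ereal t1"])
  show "\<forall>z\<in>slab T - ?K. test_fun R z = 0"
    using par_scale_less_1[OF _ assms(1,2,4)] H_eq_0 by (fastforce simp: test_fun_def not_less)
qed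

section \<open>The adjoint operator applied to the test function\<close>

definition test_adjoint :: "real \<Rightarrow> real \<times> (real ^ 'n) \<Rightarrow> real" where
  "test_adjoint R z = (let t = fst z; s = par_scale R z in
     (2 * \<rho>' t / (R * b t) - \<rho> t * b' t / (R * (b t)\<^sup>2) - \<rho> t / R) * H1 s + \<rho> t / (R * b t)\<^sup>2 * H2 s
     - 2 / R * \<rho> t * (real CARD('n) * H1 s + 2 / R * (snd z \<bullet> snd z) * H2 s))"

text \<open>The terms carrying \<open>H\<close> itself have coefficient
  \<open>\<rho>'' - (b \<rho>)' + m^2 \<rho>\<close>, which is zero; every remaining term carries
  \<open>H1\<close> or \<open>H2\<close> and is collected in \<open>test_adjoint\<close>.\<close>

lemma adjoint_operator_test_fun:
  fixes z :: "real \<times> (real ^ 'n)"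
  assumes z: "z \<in> slab T" and R: "R > 0"
  shows "time_deriv T (time_deriv T (test_fun R)) z - space_laplacian T (test_fun R) z
           - time_deriv T (\<lambda>y. b (fst y) * test_fun R y) z + (m (fst z))\<^sup>2 * test_fun R z = test_adjoint R z"
proof -
  let ?t = "fst z" and ?x = "snd z"
  have t: "0 \<le> ?t" "b ?t \<noteq> 0" using fst_slab[OF z] b_pos[of "fst z"] by auto
  have dd: "dir_deriv (slab T) w (dir_deriv (slab T) v (test_fun R)) z = test_fun_deriv2 R v w z" for v w :: "real \<times> (real ^ 'n)"
    by (rule dir_deriv_slab[OF z dir_deriv_test_fun_has_derivative[OF z R]])
  have tb: "time_deriv T (\<lambda>y. b (fst y) * test_fun R y) z = b' ?t * test_fun R z + b ?t * test_fun_deriv R (1,0) z"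
    using dir_deriv_slab[OF z has_derivative_mult[OF has_derivative_fst_slab[OF z b_deriv[OF t(1)]] test_fun_has_derivative[OF z]], of "(1,0)"]
    by simp
  have "space_laplacian T (test_fun R) z = (\<Sum>i\<in>UNIV. test_fun_deriv2 R (0, axis i 1) (0, axis i 1) z)"
    unfolding space_laplacian_def by (simp add: dd)
  \<comment> \<open>In a spatial direction only the third building block survives; the squares of
    the coordinates then add up to \<open>|x|^2\<close>.\<close>
  also have "\<dots> = (\<Sum>i\<in>UNIV. 2 / R * \<rho> ?t * H1 (par_scale R z) + (2 / R)\<^sup>2 * \<rho> ?t * H2 (par_scale R z) * (?x $ i * ?x $ i))"
    by (intro sum.cong) (auto simp: test_fun_deriv2_def product_term_deriv_def inner_axis power2_eq_square)
  also have "\<dots> = real CARD('n) * (2 / R * \<rho> ?t * H1 (par_scale R z)) + (2 / R)\<^sup>2 * \<rho> ?t * H2 (par_scale R z) * (?x \<bullet> ?x)"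
    by (simp only: sum.distrib sum_constant inner_vec_def inner_real_def sum_distrib_left)
  also have "\<dots> = 2 / R * \<rho> ?t * (real CARD('n) * H1 (par_scale R z) + 2 / R * (?x \<bullet> ?x) * H2 (par_scale R z))"
    by (simp add: power2_eq_square algebra_simps)
  finally have lap: "space_laplacian T (test_fun R) z = \<dots>" .
  have ode: "\<rho>'' ?t = b' ?t * \<rho> ?t + b ?t * \<rho>' ?t - (m ?t)\<^sup>2 * \<rho> ?t" using adjoint[OF t(1)] by simp
  show ?thesis
    unfolding dd tb lap test_adjoint_def Let_def
    using t R by (simp add: test_fun_deriv_def test_fun_deriv2_def product_term_def product_term_deriv_def test_fun_def ode) (simp add: field_simps power2_eq_square)
qed

text \<open>Only the shell contributes, and there \<open>1 + B \<le> R\<close> and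
  \<open>|x|^2 \<le> R\<close>. The constant collects \<open>3C + 1\<close> and \<open>C\<close>
  from the terms with time derivatives and \<open>2(n + 2)\<close> from the Laplacian.\<close>

lemma test_adjoint_bound:
  fixes z :: "real \<times> (real ^ 'n)"
  assumes z: "z \<in> slab T" and R: "R > 0"
  shows "\<bar>test_adjoint R z\<bar> \<le> c\<^sub>H * (4 * C + 5 + 2 * real CARD('n)) / R * \<rho> (fst z) *
           (H (par_scale R z) powr (1/p) * indicator {1/2<..<1} (par_scale R z))"
proof (cases "1/2 < par_scale R z \<and> par_scale R z < 1")
  case False
  then have "H1 (par_scale R z) = 0" "H2 (par_scale R z) = 0" using H1_eq_0 H2_eq_0 by (auto simp: not_less)
  then show ?thesis using False by (simp add: test_adjoint_def)
next
  case True
  let ?t = "fst z" and ?x = "snd z" and ?s = "par_scale R z"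
  define Q where "Q = c\<^sub>H * H (par_scale R z) powr (1/p)"
  have Q: "\<bar>H1 ?s\<bar> \<le> Q" "\<bar>H2 ?s\<bar> \<le> Q" "0 \<le> Q" using H1_bound H2_bound cH_pos by (auto simp: Q_def)
  have t: "0 \<le> ?t" using fst_slab[OF z] .
  note bp = b_pos[OF t] and rp = rho_pos[OF t]
  have s: "1 + B ?t + ?x \<bullet> ?x < R" using True R by (simp add: par_scale_def)
  then have BR: "1 + B ?t \<le> R" and xR: "?x \<bullet> ?x \<le> R"
    using B_nonneg[OF t] inner_ge_zero[of ?x] by linarith+
  have 1: "\<bar>2 * \<rho>' ?t / (R * b ?t)\<bar> \<le> 2 * C / R * \<rho> ?t"
    using rho'_bound[OF t] bp R by (simp add: abs_mult field_simps)
  have 2: "\<bar>\<rho> ?t * b' ?t / (R * (b ?t)\<^sup>2)\<bar> \<le> C / R * \<rho> ?t"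
    using b'_bound[OF t] bp R rp by (simp add: abs_mult field_simps)
  \<comment> \<open>Trades one of the two factors \<open>1 / R\<close> against
    \<open>1 / b^2\<close>, so that this term too is \<open>O(\<rho> / R)\<close>.\<close>
  have "1 / (b ?t)\<^sup>2 \<le> C * R"
    using b_inverse_bound[OF t] BR C_pos by (meson mult_left_mono less_imp_le order.trans)
  then have "\<rho> ?t / R\<^sup>2 * (1 / (b ?t)\<^sup>2) \<le> \<rho> ?t / R\<^sup>2 * (C * R)"
    using rp R by (intro mult_left_mono) auto
  then have 3: "\<bar>\<rho> ?t / (R * b ?t)\<^sup>2\<bar> \<le> C / R * \<rho> ?t"
    using rp R by (simp add: power_mult_distrib power2_eq_square field_simps)
  have 4: "\<bar>2 / R * (?x \<bullet> ?x)\<bar> \<le> 2" using xR R by (simp add: field_simps)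
  have A: "\<bar>2 * \<rho>' ?t / (R * b ?t) - \<rho> ?t * b' ?t / (R * (b ?t)\<^sup>2) - \<rho> ?t / R\<bar> \<le> (3 * C + 1) / R * \<rho> ?t"
  proof -
    have "\<bar>\<rho> ?t / R\<bar> = 1 / R * \<rho> ?t" using rp R by simp
    moreover have "(3 * C + 1) / R * \<rho> ?t = 2 * C / R * \<rho> ?t + C / R * \<rho> ?t + 1 / R * \<rho> ?t"
      using R by (simp add: field_simps)
    ultimately show ?thesis using 1 2 by linarith
  qed
  have "\<bar>real CARD('n) * H1 ?s + 2 / R * (?x \<bullet> ?x) * H2 ?s\<bar>
      \<le> real CARD('n) * \<bar>H1 ?s\<bar> + \<bar>2 / R * (?x \<bullet> ?x)\<bar> * \<bar>H2 ?s\<bar>"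
    by (metis abs_mult abs_of_nat abs_triangle_ineq)
  also have "\<dots> \<le> real CARD('n) * Q + 2 * Q"
    by (intro add_mono mult_mono Q 4) (use Q in auto)
  finally have 5: "\<bar>2 / R * \<rho> ?t * (real CARD('n) * H1 ?s + 2 / R * (?x \<bullet> ?x) * H2 ?s)\<bar>
      \<le> 2 / R * \<rho> ?t * (real CARD('n) * Q + 2 * Q)"
    unfolding abs_mult[of "2 / R * \<rho> ?t"] using R rp by (intro mult_mono) auto
  have 6: "\<bar>(2 * \<rho>' ?t / (R * b ?t) - \<rho> ?t * b' ?t / (R * (b ?t)\<^sup>2) - \<rho> ?t / R) * H1 ?s\<bar> \<le> (3 * C + 1) / R * \<rho> ?t * Q"
    unfolding abs_mult[of _ "H1 _"] by (intro mult_mono A Q) (use R rp C_pos in auto)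
  have 7: "\<bar>\<rho> ?t / (R * b ?t)\<^sup>2 * H2 ?s\<bar> \<le> C / R * \<rho> ?t * Q"
    unfolding abs_mult[of _ "H2 _"] by (intro mult_mono 3 Q) (use R rp C_pos in auto)
  have "\<bar>test_adjoint R z\<bar> \<le> (3 * C + 1) / R * \<rho> ?t * Q + C / R * \<rho> ?t * Q + 2 / R * \<rho> ?t * (real CARD('n) * Q + 2 * Q)"
    unfolding test_adjoint_def Let_def using 5 6 7 by linarith
  also have "\<dots> = (4 * C + 5 + 2 * real CARD('n)) / R * \<rho> ?t * Q"
    using R by (simp add: field_simps)
  finally show ?thesis using True by (simp add: Q_def mult_ac)
qed

section \<open>Parabolic regions and integrals over them\<close>

definition inner_region :: "real \<Rightarrow> (real \<times> (real ^ 'n)) set" where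
  "inner_region R = {z \<in> slab \<infinity>. par_scale R z < 1}"

text \<open>Continuity of \<open>par_scale\<close> is available on the slab only, so it is cut off
  by the indicator of the slab before measurability is invoked.\<close>

lemma inner_region_borel [measurable]: "(inner_region R :: (real \<times> (real ^ 'n)) set) \<in> sets borel"
proof -
  have "(\<lambda>z :: real \<times> (real ^ 'n). indicat_real (slab \<infinity>) z *\<^sub>R par_scale R z) \<in> borel_measurable borel"
    by (rule borel_measurable_continuous_on_indicator) (auto intro: par_scale_continuous slab_borel)
  then have m: "{z \<in> space borel. indicat_real (slab \<infinity>) z *\<^sub>R par_scale R (z :: real \<times> (real ^ 'n)) < 1} \<in> sets borel"
    by measurable
  have eq: "inner_region R = slab \<infinity> \<inter> {z \<in> space borel. indicat_real (slab \<infinity>) z *\<^sub>R par_scale R (z :: real \<times> (real ^ 'n)) < 1}"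
    by (auto simp: inner_region_def)
  show ?thesis unfolding eq by (rule sets.Int[OF slab_borel m])
qed

lemma inner_region_subset:
  assumes "0 < R" "0 \<le> t1" "R \<le> 1 + B t1"
  shows "inner_region R \<subseteq> {0..t1} \<times> cball (0 :: real ^ 'n) (sqrt R)"
  using par_scale_less_1[OF _ assms] by (auto simp: inner_region_def)

lemma inner_region_half: "0 < R \<Longrightarrow> inner_region (R/2) \<subseteq> inner_region R"
  by (auto simp: inner_region_def par_scale_def field_simps)

lemma inner_region_half_iff: "0 < R \<Longrightarrow> z \<in> inner_region (R/2) \<longleftrightarrow> z \<in> slab \<infinity> \<and> par_scale R z < 1/2"
  by (auto simp: inner_region_def par_scale_def field_simps)

lemma cbox_slab:
  assumes "ereal t1 < T"
  shows "{0..t1} \<times> (A :: (real ^ 'n) set) \<subseteq> slab T"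
  using assms by (auto simp: slab_def intro: le_less_trans[of _ "ereal t1"])

text \<open>Local integrability covers the compact box, on which the continuous weight
  \<open>W\<close> is bounded; the integrand is dominated by a multiple of
  \<open>\<bar>u\<bar>^p\<close> there.\<close>

lemma weighted_integrable:
  fixes u :: "real \<times> (real ^ 'n) \<Rightarrow> real"
  assumes u: "Lp_loc p T u" and t1: "0 \<le> t1" "ereal t1 < T"
    and E: "E \<in> sets borel" "E \<subseteq> {0..t1} \<times> cball 0 r"
    and W: "continuous_on (slab \<infinity>) W"
  shows "integrable lebesgue (\<lambda>z. indicator E z * W z * \<bar>u z\<bar> powr p)"
proof -
  let ?K = "{0..t1} \<times> cball (0 :: real ^ 'n) r"
  have K: "compact ?K" by (intro compact_Times) auto
  have KT: "?K \<subseteq> slab T" by (rule cbox_slab[OF t1(2)])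
  have Ki: "?K \<subseteq> slab \<infinity>" by (rule cbox_slab) simp
  have U: "integrable lebesgue (\<lambda>z. indicator ?K z * \<bar>u z\<bar> powr p)"
    using u K KT unfolding Lp_loc_def set_integrable_def by simp
  have "bounded (W ` ?K)"
    by (intro compact_imp_bounded compact_continuous_image K continuous_on_subset[OF W Ki])
  then obtain M where M: "M > 0" "\<And>z. z \<in> ?K \<Longrightarrow> \<bar>W z\<bar> \<le> M"
    unfolding bounded_pos by force
  have "(\<lambda>z. indicat_real E z *\<^sub>R W z) \<in> borel_measurable borel"
    using E Ki by (intro borel_measurable_continuous_on_indicator) (auto intro: continuous_on_subset[OF W])
  then have Wm: "(\<lambda>z. indicat_real E z * W z) \<in> borel_measurable lebesgue"
    by (simp add: measurable_completion)
  have eq: "indicator E z * W z * \<bar>u z\<bar> powr p = (indicator E z * W z) * (indicator ?K z * \<bar>u z\<bar> powr p)" for z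
    using E(2) by (auto simp: indicator_def)
  show ?thesis
  proof (rule Bochner_Integration.integrable_bound)
    show "integrable lebesgue (\<lambda>z. M * (indicator ?K z * \<bar>u z\<bar> powr p))" using U by simp
    show "(\<lambda>z. indicator E z * W z * \<bar>u z\<bar> powr p) \<in> borel_measurable lebesgue"
      unfolding eq by (rule borel_measurable_times[OF Wm borel_measurable_integrable[OF U]])
    show "AE z in lebesgue. norm (indicator E z * W z * \<bar>u z\<bar> powr p) \<le> norm (M * (indicator ?K z * \<bar>u z\<bar> powr p))"
    proof (intro AE_I2)
      fix z
      show "norm (indicator E z * W z * \<bar>u z\<bar> powr p) \<le> norm (M * (indicator ?K z * \<bar>u z\<bar> powr p))"
        using M E(2) by (auto simp: indicator_def abs_mult intro!: mult_right_mono)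
    qed
  qed
qed

text \<open>The quantity \<open>A(R)\<close> of the overview. The region is taken in the slab up to
  \<open>\<infinity>\<close>, so no \<open>T\<close> appears; if \<open>R \<le> 1 + B t1\<close>
  with \<open>t1 < T\<close>, it lies inside the slab of the solution.\<close>

definition mass_in :: "(real \<times> (real ^ 'n) \<Rightarrow> real) \<Rightarrow> real \<Rightarrow> real" where
  "mass_in u R = (LINT z|lebesgue. indicator (inner_region R) z * \<rho> (fst z) * \<bar>u z\<bar> powr p)"

definition data_term :: "(real ^ 'n \<Rightarrow> real) \<Rightarrow> (real ^ 'n \<Rightarrow> real) \<Rightarrow> real \<Rightarrow> real" where
  "data_term f g R = (LINT x|lebesgue. g x * test_fun R (0, x) + b 0 * f x * test_fun R (0, x)
     - f x * test_fun_deriv R (1, 0) (0, x))"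

lemma mass_in_nonneg: "0 \<le> mass_in (u :: real \<times> (real ^ 'n) \<Rightarrow> real) R"
  unfolding mass_in_def
  by (intro integral_nonneg_AE AE_I2) (auto simp: indicator_def inner_region_def slab_def intro!: mult_nonneg_nonneg less_imp_le[OF rho_pos])

text \<open>At \<open>t = 0\<close> the scale \<open>(1 + |x|^2) / R\<close> tends to 0, so
  \<open>H\<close> tends to 1 and \<open>H1\<close> to 0 pointwise. Dominated convergence yields the
  functional \<open>J0\<close>, whose positivity thus passes to the data term for large
  \<open>R\<close>.\<close>

lemma data_term_tendsto:
  fixes f g :: "real ^ 'n \<Rightarrow> real"
  assumes f: "integrable lebesgue f" and g: "integrable lebesgue g"
  shows "(data_term f g \<longlongrightarrow> \<rho> 0 * (LINT x|lebesgue. g x) + (b 0 * \<rho> 0 - \<rho>' 0) * (LINT x|lebesgue. f x)) at_top"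
proof -
  define q where "q R x = (1 + x \<bullet> x) / R" for R and x :: "real ^ 'n"
  let ?s = "\<lambda>R x. g x * (\<rho> 0 * H (q R x)) + b 0 * f x * (\<rho> 0 * H (q R x))
     - f x * (\<rho>' 0 * H (q R x) + \<rho> 0 / (R * b 0) * H1 (q R x))"
  let ?l = "\<lambda>x. \<rho> 0 * g x + (b 0 * \<rho> 0 - \<rho>' 0) * f x"
  \<comment> \<open>Majorant valid for \<open>R \<ge> 1\<close>, from
    \<open>\<bar>H\<bar> \<le> 1\<close>, \<open>\<bar>H1\<bar> \<le> c\<^sub>H\<close> and
    \<open>1 / (R * b 0) \<le> 1 / b 0\<close>.\<close>
  let ?w = "\<lambda>x. \<bar>g x\<bar> * \<rho> 0 + b 0 * \<bar>f x\<bar> * \<rho> 0 + \<bar>f x\<bar> * (\<bar>\<rho>' 0\<bar> + \<rho> 0 / b 0 * c\<^sub>H)"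
  have b0: "0 < b 0" and r0: "0 < \<rho> 0" using b_pos rho_pos by auto
  have q0: "((\<lambda>R. q R x) \<longlongrightarrow> 0) at_top" for x
    unfolding q_def by (intro tendsto_divide_0[OF tendsto_const] filterlim_at_top_imp_at_infinity filterlim_ident)
  have H0: "((\<lambda>R. H (q R x)) \<longlongrightarrow> 1) at_top" for x
    using isCont_tendsto_compose[OF DERIV_isCont[OF H_deriv] q0, of x] H_eq_1[of 0] by simp
  have H10: "((\<lambda>R. H1 (q R x)) \<longlongrightarrow> 0) at_top" for x
    using isCont_tendsto_compose[OF DERIV_isCont[OF H1_deriv] q0, of x] H1_eq_0[of 0] by simp
  have Rb: "((\<lambda>R. \<rho> 0 / (R * b 0)) \<longlongrightarrow> 0) at_top"
    using b0 by (intro tendsto_divide_0[OF tendsto_const] filterlim_at_top_imp_at_infinity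
         filterlim_at_top_mult_tendsto_pos[OF tendsto_const _ filterlim_ident])
  have Hc: "(\<lambda>x. H (q R x)) \<in> borel_measurable lebesgue" "(\<lambda>x. H1 (q R x)) \<in> borel_measurable lebesgue" for R
  proof -
    have "continuous_on UNIV (q R)"
      unfolding q_def by (cases "R = 0") (auto intro!: continuous_intros)
    then have "(\<lambda>x. H (q R x)) \<in> borel_measurable borel" "(\<lambda>x. H1 (q R x)) \<in> borel_measurable borel"
      by (intro borel_measurable_continuous_onI continuous_on_compose2[OF coeff_continuous(5)] continuous_on_compose2[OF coeff_continuous(6)]; simp)+
    then show "(\<lambda>x. H (q R x)) \<in> borel_measurable lebesgue" "(\<lambda>x. H1 (q R x)) \<in> borel_measurable lebesgue"
      by (simp_all add: measurable_completion)
  qed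
  have fm: "f \<in> borel_measurable lebesgue" "g \<in> borel_measurable lebesgue" using f g by auto
  have "((\<lambda>R. LINT x|lebesgue. ?s R x) \<longlongrightarrow> (LINT x|lebesgue. ?l x)) at_top"
  proof (rule integral_dominated_convergence_at_top[where w = ?w])
    show "integrable lebesgue ?w" using f g by (intro Bochner_Integration.integrable_add integrable_mult_left integrable_mult_right integrable_abs)
    show "?l \<in> borel_measurable lebesgue" using fm by measurable
    show "?s R \<in> borel_measurable lebesgue" for R using fm Hc by measurable
    show "AE x in lebesgue. ((\<lambda>R. ?s R x) \<longlongrightarrow> ?l x) at_top"
    proof (intro AE_I2)
      fix x
      have "((\<lambda>R. ?s R x) \<longlongrightarrow> g x * (\<rho> 0 * 1) + b 0 * f x * (\<rho> 0 * 1) - f x * (\<rho>' 0 * 1 + 0 * 0)) at_top"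
        by (intro tendsto_add tendsto_diff tendsto_mult tendsto_const H0 H10 Rb)
      then show "((\<lambda>R. ?s R x) \<longlongrightarrow> ?l x) at_top" by (simp add: algebra_simps)
    qed
    show "\<forall>\<^sub>F R in at_top. AE x in lebesgue. norm (?s R x) \<le> ?w x"
      using eventually_ge_at_top[of 1]
    proof eventually_elim
      case (elim R)
      show ?case
      proof (intro AE_I2)
        fix x
        have H: "\<bar>H (q R x)\<bar> \<le> 1" using H_ge_0 H_le_1 by (simp add: abs_le_iff add_increasing)
        have "H (q R x) powr (1/p) \<le> 1" using H_ge_0 H_le_1 p by (intro powr_le1) auto
        then have "c\<^sub>H * H (q R x) powr (1/p) \<le> c\<^sub>H * 1"
          using cH_pos by (intro mult_left_mono) auto
        then have H1: "\<bar>H1 (q R x)\<bar> \<le> c\<^sub>H" using H1_bound[of "q R x"] by linarith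
        have 1: "\<bar>g x * (\<rho> 0 * H (q R x))\<bar> \<le> \<bar>g x\<bar> * (\<rho> 0 * 1)"
          unfolding abs_mult using H r0 by (intro mult_mono) auto
        have 2: "\<bar>b 0 * f x * (\<rho> 0 * H (q R x))\<bar> \<le> b 0 * \<bar>f x\<bar> * (\<rho> 0 * 1)"
          unfolding abs_mult using H r0 b0 by (intro mult_mono) auto
        have "\<rho> 0 / (R * b 0) \<le> \<rho> 0 / b 0"
          using r0 b0 elim by (intro divide_left_mono) auto
        then have "\<bar>\<rho> 0 / (R * b 0) * H1 (q R x)\<bar> \<le> \<rho> 0 / b 0 * c\<^sub>H"
          unfolding abs_mult using H1 r0 b0 elim cH_pos by (intro mult_mono) auto
        moreover have "\<bar>\<rho>' 0 * H (q R x)\<bar> \<le> \<bar>\<rho>' 0\<bar> * 1"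
          unfolding abs_mult using H by (intro mult_mono) auto
        ultimately have "\<bar>\<rho>' 0 * H (q R x) + \<rho> 0 / (R * b 0) * H1 (q R x)\<bar> \<le> \<bar>\<rho>' 0\<bar> + \<rho> 0 / b 0 * c\<^sub>H"
          by linarith
        then have 3: "\<bar>f x * (\<rho>' 0 * H (q R x) + \<rho> 0 / (R * b 0) * H1 (q R x))\<bar>
            \<le> \<bar>f x\<bar> * (\<bar>\<rho>' 0\<bar> + \<rho> 0 / b 0 * c\<^sub>H)"
          unfolding abs_mult by (intro mult_left_mono) auto
        show "norm (?s R x) \<le> ?w x" using 1 2 3 unfolding real_norm_def by linarith
      qed
    qed
  qed
  moreover have "(LINT x|lebesgue. ?l x) = \<rho> 0 * (LINT x|lebesgue. g x) + (b 0 * \<rho> 0 - \<rho>' 0) * (LINT x|lebesgue. f x)"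
    using f g by simp
  moreover have "data_term f g = (\<lambda>R. LINT x|lebesgue. ?s R x)"
    unfolding data_term_def test_fun_def test_fun_deriv_def product_term_def par_scale_def q_def by (simp add: B_0)
  ultimately show ?thesis by simp
qed

text \<open>The region sits in \<open>{0..t1}\<close> times the ball of radius
  \<open>sqrt R\<close>. The bound \<open>\<rho> \<le> E / b\<close> integrates in time to
  \<open>E * B t1 \<le> E * R\<close>, and the ball contributes the factor
  \<open>R^(n/2)\<close>.\<close>

lemma volume_bound:
  fixes E :: real
  assumes t1: "0 \<le> t1" and R: "R = 1 + B t1" and E: "\<And>t. 0 \<le> t \<Longrightarrow> t \<le> t1 \<Longrightarrow> b t * \<rho> t \<le> E"
  shows "integrable lebesgue (\<lambda>z :: real \<times> (real ^ 'n). indicator (inner_region R) z * \<rho> (fst z))" (is ?A)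
    and "(LINT z :: real \<times> (real ^ 'n)|lebesgue. indicator (inner_region R) z * \<rho> (fst z))
          \<le> unit_ball_vol (real CARD('n)) * E * R powr (real CARD('n) / 2 + 1)" (is ?B)
proof -
  let ?F = "\<lambda>z :: real \<times> (real ^ 'n). indicator (inner_region R) z * \<rho> (fst z)"
  let ?K = "cball (0 :: real ^ 'n) (sqrt R)"
  let ?bound = "unit_ball_vol (real CARD('n)) * E * R powr (real CARD('n) / 2 + 1)"
  have R1: "R \<ge> 1" using R B_nonneg[OF t1] by simp
  have "0 < b 0 * \<rho> 0" using b_pos rho_pos by simp
  then have E0: "0 < E" using E[of 0] t1 by simp
  have Fm: "?F \<in> borel_measurable borel"
  proof -
    have "(\<lambda>z :: real \<times> (real ^ 'n). indicat_real (inner_region R) z *\<^sub>R \<rho> (fst z)) \<in> borel_measurable borel"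
      by (rule borel_measurable_continuous_on_indicator[OF inner_region_borel])
         (auto intro: continuous_on_subset[OF continuous_on_fst_slab[OF coeff_continuous(2)], of _ \<infinity>] simp: inner_region_def)
    then show ?thesis by simp
  qed
  have F0: "0 \<le> ?F z" for z using rho_pos[of "fst z"] by (auto simp: indicator_def inner_region_def slab_def)
  have "((\<lambda>t. E * (1 / b t)) has_integral E * (B t1 - B 0)) {0..t1}"
    by (intro has_integral_mult_right fundamental_theorem_of_calculus[OF t1])
       (auto simp: has_real_derivative_iff_has_vector_derivative[symmetric] intro: DERIV_subset[OF B_deriv])
  moreover have "(\<lambda>t. E * (1 / b t)) integrable_on {0..t1}" using calculation by blast
  moreover have ri: "\<rho> integrable_on {0..t1}"
    by (intro integrable_continuous_interval continuous_on_subset[OF coeff_continuous(2)]) auto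
  moreover have "\<rho> t \<le> E * (1 / b t)" if "t \<in> {0..t1}" for t
    using E[of t] b_pos[of t] that by (simp add: field_simps)
  ultimately have "integral {0..t1} \<rho> \<le> E * (B t1 - B 0)"
    by (metis (no_types, lifting) integral_le integral_unique)
  then have int: "integral {0..t1} \<rho> \<le> E * R" using R E0 B_0 by (simp add: algebra_simps)
  have "(\<rho> has_integral integral {0..t1} \<rho>) {0..t1}" using ri by blast
  then have nn1: "(\<integral>\<^sup>+ t. ennreal (indicator {0..t1} t * \<rho> t) \<partial>lborel) = ennreal (integral {0..t1} \<rho>)"
  proof (intro nn_integral_has_integral_lborel)
    have "(\<lambda>t. indicat_real {0..t1} t *\<^sub>R \<rho> t) \<in> borel_measurable borel"
      by (intro borel_measurable_continuous_on_indicator continuous_on_subset[OF coeff_continuous(2)]) auto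
    then show "(\<lambda>t. indicat_real {0..t1} t * \<rho> t) \<in> borel_measurable borel" by simp
    show "0 \<le> indicat_real {0..t1} t * \<rho> t" for t using rho_pos[of t] by (auto simp: indicator_def)
    assume "(\<rho> has_integral integral {0..t1} \<rho>) {0..t1}"
    then have "((\<lambda>t. if t \<in> {0..t1} then \<rho> t else 0) has_integral integral {0..t1} \<rho>) UNIV"
      by (simp only: has_integral_restrict_UNIV)
    then show "((\<lambda>t. indicat_real {0..t1} t * \<rho> t) has_integral integral {0..t1} \<rho>) UNIV"
      by (rule has_integral_eq[rotated]) (auto simp: indicator_def)
  qed
  have m1: "(\<lambda>t. ennreal (indicator {0..t1} t * \<rho> t)) \<in> borel_measurable lborel"
  proof -
    have "(\<lambda>t. indicat_real {0..t1} t *\<^sub>R \<rho> t) \<in> borel_measurable borel"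
      by (intro borel_measurable_continuous_on_indicator continuous_on_subset[OF coeff_continuous(2)]) auto
    then show ?thesis by simp
  qed
  \<comment> \<open>Enlarging the region to a product set separates the factors for Tonelli.\<close>
  have "(\<integral>\<^sup>+ z. ennreal (?F z) \<partial>lborel)
     \<le> (\<integral>\<^sup>+ z. ennreal (indicator {0..t1} (fst z) * \<rho> (fst z)) * indicator ?K (snd z) \<partial>lborel)"
  proof (intro nn_integral_mono)
    fix z :: "real \<times> (real ^ 'n)"
    have "inner_region R \<subseteq> {0..t1} \<times> ?K" using R1 t1 R by (intro inner_region_subset) auto
    then show "ennreal (?F z) \<le> ennreal (indicator {0..t1} (fst z) * \<rho> (fst z)) * indicator ?K (snd z)"
      by (cases z) (auto simp: indicator_def)
  qed
  also have "\<dots> = (\<integral>\<^sup>+ z. ennreal (indicator {0..t1} (fst z) * \<rho> (fst z)) * indicator ?K (snd z) \<partial>(lborel \<Otimes>\<^sub>M lborel))"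
    by (simp add: lborel_prod)
  also have "\<dots> = (\<integral>\<^sup>+ t. \<integral>\<^sup>+ x. ennreal (indicator {0..t1} t * \<rho> t) * indicator ?K x \<partial>lborel \<partial>lborel)"
  proof (subst lborel.nn_integral_fst[symmetric])
    have "(\<lambda>z :: real \<times> (real ^ 'n). indicator ?K (snd z) :: ennreal) \<in> borel_measurable (lborel \<Otimes>\<^sub>M lborel)"
      by (rule measurable_compose[OF measurable_snd], rule borel_measurable_indicator) auto
    then show "(\<lambda>z. ennreal (indicator {0..t1} (fst z) * \<rho> (fst z)) * indicator ?K (snd z)) \<in> borel_measurable (lborel \<Otimes>\<^sub>M lborel)"
      by (rule borel_measurable_times_ennreal[OF measurable_compose[OF measurable_fst m1]])
  qed simp
  also have "\<dots> = (\<integral>\<^sup>+ t. ennreal (indicator {0..t1} t * \<rho> t) * emeasure lborel ?K \<partial>lborel)"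
    by (simp add: nn_integral_cmult_indicator)
  also have "\<dots> = ennreal (integral {0..t1} \<rho>) * emeasure lborel ?K"
    using m1 by (subst nn_integral_multc) (simp_all add: nn1)
  also have "emeasure lborel ?K = ennreal (unit_ball_vol (real CARD('n)) * R powr (real CARD('n) / 2))"
  proof -
    have "sqrt R ^ CARD('n) = R powr (real CARD('n) / 2)"
      using R1 by (simp add: powr_half_sqrt[symmetric] powr_powr flip: powr_realpow)
    then show ?thesis using R1 by (simp add: emeasure_cball)
  qed
  also have "ennreal (integral {0..t1} \<rho>) * \<dots> \<le> ennreal (E * R) * ennreal (unit_ball_vol (real CARD('n)) * R powr (real CARD('n) / 2))"
    by (intro mult_right_mono ennreal_leI int) auto
  also have "\<dots> = ennreal ?bound"
    using R1 E0 by (subst ennreal_mult'[symmetric]) (simp_all add: powr_add mult_ac)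
  finally have nn: "(\<integral>\<^sup>+ z. ennreal (?F z) \<partial>lborel) \<le> ennreal ?bound" .
  have "integrable lborel ?F"
    using Fm F0 nn by (intro integrableI_bounded) (auto simp: less_top[symmetric] top_unique)
  moreover have "integral\<^sup>L lborel ?F \<le> ?bound"
    using Fm F0 nn E0 by (subst integral_eq_nn_integral) (auto intro!: enn2real_leI)
  ultimately show ?A ?B
    using Fm by (simp_all add: integrable_completion integral_completion)
qed

text \<open>Insert \<open>test_fun R\<close> into the weak formulation. The right side lives on the
  shell and is split by Young's inequality, \<open>\<bar>u\<bar> H^(1/p)\<close> against a constant;
  the \<open>p\<close>-th power returns the factor \<open>H\<close> and so reproduces the test
  function. \<open>G\<close> is that constant to the conjugate exponent times the bound on the
  weighted volume.\<close>

lemma weak_estimate: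
  fixes f g :: "real ^ 'n \<Rightarrow> real" and u :: "real \<times> (real ^ 'n) \<Rightarrow> real"
  assumes weak: "weak_solution b m f g p \<epsilon> T u"
    and t1: "0 \<le> t1" "ereal t1 < T" and R: "R = 1 + B t1"
    and E: "\<And>t. 0 \<le> t \<Longrightarrow> t \<le> t1 \<Longrightarrow> b t * \<rho> t \<le> E"
  defines "G \<equiv> (c\<^sub>H * (4 * C + 5 + 2 * real CARD('n)) / R) powr (p / (p - 1)) *
                (unit_ball_vol (real CARD('n)) * E * R powr (real CARD('n) / 2 + 1))"
  shows "0 < l \<Longrightarrow> mass_in u (R/2) + \<epsilon> * data_term f g R
           \<le> l * (mass_in u R - mass_in u (R/2)) + l powr (- 1 / (p - 1)) * G" (is "_ \<Longrightarrow> ?A")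
    and "mass_in u (R/2) \<le> mass_in u R" (is ?B)
    and "mass_in u (R/2) / 2 + \<epsilon> * data_term f g R \<le> 2 powr (1 / (p - 1)) * G" (is ?C)
proof -
  have R1: "R \<ge> 1" using R B_nonneg[OF t1(1)] by simp
  then have R0: "0 < R" by simp
  define Mc where "Mc = c\<^sub>H * (4 * C + 5 + 2 * real CARD('n)) / R"
  have Mc: "0 \<le> Mc" using cH_pos C_pos R0 by (simp add: Mc_def)
  have Lp: "Lp_loc p T u" using weak by (simp add: weak_solution_def)
  have sub: "inner_region R \<subseteq> {0..t1} \<times> cball (0 :: real ^ 'n) (sqrt R)"
    using R by (intro inner_region_subset R0 t1) simp
  have subh: "inner_region (R/2) \<subseteq> {0..t1} \<times> cball (0 :: real ^ 'n) (sqrt R)" using inner_region_half[OF R0] sub by blast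
  define Sh :: "(real \<times> (real ^ 'n)) set" where "Sh = inner_region R - inner_region (R/2)"
  have Shb: "Sh \<in> sets borel" unfolding Sh_def by auto
  have Shs: "Sh \<subseteq> {0..t1} \<times> cball (0 :: real ^ 'n) (sqrt R)" using sub by (auto simp: Sh_def)
  have c\<rho>: "continuous_on (slab \<infinity>) (\<lambda>z :: real \<times> (real ^ 'n). \<rho> (fst z))"
    by (rule continuous_on_fst_slab[OF coeff_continuous(2)])
  have cH: "continuous_on (slab \<infinity>) (\<lambda>z :: real \<times> (real ^ 'n). test_fun R z)"
    unfolding test_fun_def by (intro continuous_intros c\<rho> continuous_on_compose2[OF coeff_continuous(5) par_scale_continuous]) auto
  note int = weighted_integrable[OF Lp t1]
  note iA = int[OF inner_region_borel sub c\<rho>] and iAh = int[OF inner_region_borel subh c\<rho>] and iSh = int[OF Shb Shs c\<rho>]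
    and iI = int[OF inner_region_borel sub cH] and iD = int[OF Shb Shs cH]
  \<comment> \<open>\<open>I\<close> is the nonlinear term over the whole region and
    \<open>D\<close> its part on the shell. Since \<open>H = 1\<close> on the inner part,
    \<open>mass_in u (R/2) \<le> I\<close>; and \<open>D\<close> is at most \<open>I\<close> as well
    as the mass gained between \<open>R/2\<close> and \<open>R\<close>.\<close>
  define I where "I = (LINT z|lebesgue. indicator (inner_region R) z * test_fun R z * \<bar>u z\<bar> powr p)"
  define D where "D = (LINT z|lebesgue. indicator Sh z * test_fun R z * \<bar>u z\<bar> powr p)"
  define V where "V = (LINT z :: real \<times> (real ^ 'n)|lebesgue. indicator (inner_region R) z * \<rho> (fst z))"
  have iV: "integrable lebesgue (\<lambda>z :: real \<times> (real ^ 'n). indicator (inner_region R) z * \<rho> (fst z))"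
    and V: "V \<le> unit_ball_vol (real CARD('n)) * E * R powr (real CARD('n) / 2 + 1)"
    unfolding V_def by (rule volume_bound[OF t1(1) R]; rule E; assumption)+
  have \<rho>0: "0 < \<rho> (fst z)" if "z \<in> inner_region R" for z :: "real \<times> (real ^ 'n)"
    using that by (intro rho_pos) (simp add: inner_region_def slab_def)
  have tst0: "0 \<le> test_fun R z \<and> test_fun R z \<le> \<rho> (fst z)" if "z \<in> inner_region R" for z :: "real \<times> (real ^ 'n)"
    using \<rho>0[OF that] H_ge_0[of "par_scale R z"] H_le_1[of "par_scale R z"] by (auto simp: test_fun_def mult_left_le)
  have AI: "mass_in u (R/2) \<le> I"
    unfolding mass_in_def I_def
  proof (intro integral_mono iAh iI)
    fix z
    show "indicator (inner_region (R/2)) z * \<rho> (fst z) * \<bar>u z\<bar> powr p \<le> indicator (inner_region R) z * test_fun R z * \<bar>u z\<bar> powr p"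
    proof (cases "z \<in> inner_region (R/2)")
      case True
      then show ?thesis using inner_region_half[OF R0] H_eq_1[of "par_scale R z"] by (auto simp: inner_region_half_iff[OF R0] test_fun_def)
    next
      case False
      then show ?thesis using tst0[of z] by (auto simp: indicator_def)
    qed
  qed
  have DI: "D \<le> I"
    unfolding D_def I_def
    by (intro integral_mono iD iI) (use tst0 in \<open>auto simp: Sh_def indicator_def\<close>)
  have "(LINT z|lebesgue. indicator Sh z * \<rho> (fst z) * \<bar>u z\<bar> powr p) = mass_in u R - mass_in u (R/2)"
    unfolding mass_in_def Bochner_Integration.integral_diff[OF iA iAh, symmetric]
    by (rule Bochner_Integration.integral_cong) (use inner_region_half[OF R0] in \<open>auto simp: Sh_def indicator_def\<close>)
  moreover have "D \<le> (LINT z|lebesgue. indicator Sh z * \<rho> (fst z) * \<bar>u z\<bar> powr p)"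
    unfolding D_def
    by (intro integral_mono iD iSh) (use tst0 in \<open>auto simp: Sh_def indicator_def intro!: mult_right_mono\<close>)
  moreover have "0 \<le> D" unfolding D_def
    by (intro integral_nonneg_AE AE_I2) (use tst0 in \<open>auto simp: Sh_def indicator_def\<close>)
  ultimately have DA: "D \<le> mass_in u R - mass_in u (R/2)" and D0: "0 \<le> D" by auto
  then show ?B by linarith
  have slT: "inner_region R \<subseteq> (slab T :: (real \<times> (real ^ 'n)) set)" using sub cbox_slab[OF t1(2)] by blast
  have sl0: "(0, x) \<in> slab T" for x :: "real ^ 'n" using weak by (simp add: slab_def weak_solution_def zero_ereal_def)
  have "test_function T (test_fun R :: real \<times> (real ^ 'n) \<Rightarrow> real)"
    by (rule test_function_test_fun[OF R0 t1]) (simp add: R)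
  with weak have "(LINT z:slab T|lebesgue. \<bar>u z\<bar> powr p * test_fun R z)
        + \<epsilon> * (LINT x|lebesgue.
                 g x * test_fun R (0, x) + b 0 * f x * test_fun R (0, x) - f x * time_deriv T (test_fun R) (0, x))
        = (LINT z:slab T|lebesgue.
             u z * (time_deriv T (time_deriv T (test_fun R)) z - space_laplacian T (test_fun R) z
                    - time_deriv T (\<lambda>y. b (fst y) * test_fun R y) z
                    + (m (fst z))\<^sup>2 * test_fun R z))"
    unfolding weak_solution_def by blast
  \<comment> \<open>Within the slab the cutoff vanishes outside \<open>inner_region R\<close>, and
    that region lies in the slab, so the two integrals agree.\<close>
  moreover have "(LINT z:slab T|lebesgue. \<bar>u z\<bar> powr p * test_fun R z) = I"
    unfolding set_lebesgue_integral_def I_def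
  proof (rule Bochner_Integration.integral_cong)
    fix z
    show "indicator (slab T) z *\<^sub>R (\<bar>u z\<bar> powr p * test_fun R z) = indicator (inner_region R) z * test_fun R z * \<bar>u z\<bar> powr p"
    proof (cases "z \<in> inner_region R")
      case False
      then have "z \<in> slab T \<Longrightarrow> H (par_scale R z) = 0" by (intro H_eq_0) (auto simp: inner_region_def slab_def)
      then show ?thesis using False by (auto simp: test_fun_def indicator_def)
    qed (use slT in \<open>auto simp: indicator_def\<close>)
  qed simp
  moreover have "(LINT x|lebesgue. g x * test_fun R (0, x) + b 0 * f x * test_fun R (0, x) - f x * time_deriv T (test_fun R) (0, x)) = data_term f g R"
    unfolding data_term_def by (simp add: dir_deriv_test_fun[OF sl0])
  moreover have "(LINT z:slab T|lebesgue.
             u z * (time_deriv T (time_deriv T (test_fun R)) z - space_laplacian T (test_fun R) z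
                    - time_deriv T (\<lambda>y. b (fst y) * test_fun R y) z
                    + (m (fst z))\<^sup>2 * test_fun R z))
     = (LINT z|lebesgue. indicator (slab T) z * (u z * test_adjoint R z))"
    unfolding set_lebesgue_integral_def
    by (rule Bochner_Integration.integral_cong) (auto simp: adjoint_operator_test_fun[OF _ R0] indicator_def)
  ultimately have id: "I + \<epsilon> * data_term f g R = (LINT z|lebesgue. indicator (slab T) z * (u z * test_adjoint R z))"
    by simp
  have main: "I + \<epsilon> * data_term f g R \<le> l * D + l powr (- 1 / (p - 1)) * G" if l: "0 < l" for l
  proof -
    let ?Y = "\<lambda>z. l * (indicator Sh z * test_fun R z * \<bar>u z\<bar> powr p)
        + (l powr (- 1 / (p - 1)) * Mc powr (p / (p - 1))) * (indicator (inner_region R) z * \<rho> (fst z))"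
    have "(LINT z|lebesgue. indicator (slab T) z * (u z * test_adjoint R z)) \<le> (LINT z|lebesgue. ?Y z)"
    \<comment> \<open>An integrable nonnegative majorant suffices here: a left side that is not
      integrable has integral 0 by convention.\<close>
    proof (rule integral_mono')
      show "integrable lebesgue ?Y" by (intro Bochner_Integration.integrable_add integrable_mult_right iD iV)
      fix z :: "real \<times> (real ^ 'n)"
      have reg0: "0 \<le> indicator (inner_region R) z * \<rho> (fst z)" using \<rho>0[of z] by (auto simp: indicator_def)
      have Sh0: "0 \<le> indicator Sh z * test_fun R z" using tst0[of z] by (auto simp: indicator_def Sh_def)
      have "0 \<le> l * (indicator Sh z * test_fun R z * \<bar>u z\<bar> powr p)"
        using l by (intro mult_nonneg_nonneg[OF _ mult_nonneg_nonneg[OF Sh0]]) auto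
      moreover have "0 \<le> (l powr (- 1 / (p - 1)) * Mc powr (p / (p - 1))) * (indicator (inner_region R) z * \<rho> (fst z))"
        by (intro mult_nonneg_nonneg[OF _ reg0]) auto
      ultimately show Y0: "0 \<le> ?Y z" by (rule add_nonneg_nonneg)
      show "indicator (slab T) z * (u z * test_adjoint R z) \<le> ?Y z"
      proof (cases "z \<in> slab T \<and> 1/2 < par_scale R z \<and> par_scale R z < 1")
        case True
        then have zS: "z \<in> Sh" and zR: "z \<in> inner_region R"
          by (auto simp: Sh_def inner_region_half_iff[OF R0]) (auto simp: inner_region_def slab_def)
        let ?h = "H (par_scale R z)"
        have "u z * test_adjoint R z \<le> \<bar>u z\<bar> * \<bar>test_adjoint R z\<bar>" by (metis abs_ge_self abs_mult)
        also have "\<dots> \<le> \<bar>u z\<bar> * (Mc * \<rho> (fst z) * ?h powr (1/p))"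
          using test_adjoint_bound[of z T R] True R0 unfolding Mc_def by (intro mult_left_mono) auto
        also have "\<dots> = \<rho> (fst z) * ((\<bar>u z\<bar> * ?h powr (1/p)) * Mc)" by simp
        also have "\<dots> \<le> \<rho> (fst z) * (l * (\<bar>u z\<bar> * ?h powr (1/p)) powr p + l powr (- 1 / (p - 1)) * Mc powr (p / (p - 1)))"
          using \<rho>0[OF zR] by (intro mult_left_mono Young_with_parameter p l Mc) auto
        also have "(\<bar>u z\<bar> * ?h powr (1/p)) powr p = \<bar>u z\<bar> powr p * ?h"
          using H_ge_0[of "par_scale R z"] p by (simp add: powr_mult powr_powr)
        finally show ?thesis using True zS zR by (simp add: test_fun_def algebra_simps)
      next
        case False
        then have z0: "indicator (slab T) z * (u z * test_adjoint R z) = 0"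
          using H1_eq_0[of "par_scale R z"] H2_eq_0[of "par_scale R z"] by (auto simp: indicator_def test_adjoint_def not_less)
        show ?thesis unfolding z0 by (rule Y0)
      qed
    qed
    also have "\<dots> = l * D + (l powr (- 1 / (p - 1)) * Mc powr (p / (p - 1))) * V"
      unfolding D_def V_def by (subst Bochner_Integration.integral_add) (auto intro!: iD iV)
    also have "\<dots> \<le> l * D + l powr (- 1 / (p - 1)) * G"
      using V unfolding G_def Mc_def[symmetric] by (simp add: mult.assoc mult_left_mono)
    finally show ?thesis unfolding id .
  qed
  show ?A if l: "0 < l"
    using main[OF l] AI mult_left_mono[OF DA, of l] l by linarith
  \<comment> \<open>The weight \<open>l = 1/2\<close>: since \<open>D \<le> I\<close>, half of
    \<open>I\<close> absorbs the shell term and \<open>mass_in u (R/2) / 2\<close> survives.\<close>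
  have "(1 / 2) powr (- 1 / (p - 1)) = (2::real) powr (1 / (p - 1))"
    by (simp add: powr_divide powr_minus_divide)
  then have "I + \<epsilon> * data_term f g R \<le> 1 / 2 * D + 2 powr (1 / (p - 1)) * G"
    using main[of "1/2"] by simp
  then show ?C using DI AI by linarith
qed

lemma B_continuous: "continuous_on {0..t} B"
  by (rule continuous_on_subset[OF coeff_continuous(4)]) auto

text \<open>Intermediate value theorem: an inequality \<open>R \<le> 1 + B t\<close> becomes the
  equality that \<open>weak_estimate\<close> requires, at a possibly earlier time.\<close>

lemma B_attains:
  assumes "0 \<le> t" "1 \<le> R" "R \<le> 1 + B t"
  obtains s where "0 \<le> s" "s \<le> t" "R = 1 + B s"
proof -
  have "\<exists>s\<ge>0. s \<le> t \<and> B s = R - 1"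
    by (rule IVT') (use assms B_0 B_continuous in auto)
  then show ?thesis using that by fastforce
qed

end

section \<open>Effective damping and the accumulated mass\<close>

lemma deriv0_works:
  assumes "f differentiable_on {0..}" "0 \<le> t"
  shows "(f has_real_derivative deriv0 f t) (at t within {0..})"
  using assms unfolding deriv0_def differentiable_on_def
  by (auto simp: has_real_derivative_iff_has_vector_derivative vector_derivative_works[symmetric])

text \<open>Every point of the half line, 0 included, is a limit point of it, so the one-sided
  derivative picked out by \<open>deriv0\<close> is determined.\<close>

lemma deriv0_eq:
  assumes "(f has_real_derivative d) (at t within {0..})" "0 \<le> t"
  shows "deriv0 f t = d"
proof -
  have "t islimpt {t..t+1}" by (simp add: islimpt_Icc)
  then have "t islimpt {0..}" by (rule islimpt_subset) (use assms in auto)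
  then have "at t within {0..} \<noteq> bot" by (simp add: trivial_limit_within)
  then show ?thesis
    unfolding deriv0_def using assms(1)
    by (intro vector_derivative_within) (simp_all add: has_real_derivative_iff_has_vector_derivative)
qed

lemma B_int_deriv:
  assumes c: "continuous_on {0..} b" and pos: "\<And>t. 0 \<le> t \<Longrightarrow> 0 < b t" and t: "0 \<le> t"
  shows "(B_int b has_real_derivative 1 / b t) (at t within {0..})"
proof -
  \<comment> \<open>The interval reaches past \<open>t\<close>, so that near \<open>t\<close> it
    coincides with the half line, also for \<open>t = 0\<close>.\<close>
  have "continuous_on {0..t+1} (\<lambda>s. 1 / b s)"
    by (intro continuous_intros continuous_on_subset[OF c]) (use pos in \<open>fastforce+\<close>)
  then have "((\<lambda>u. integral {0..u} (\<lambda>s. 1 / b s)) has_vector_derivative 1 / b t) (at t within {0..t+1})"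
    using t by (intro integral_has_vector_derivative) auto
  moreover have "at t within {0..t+1} = at t within {0..}"
    by (rule at_within_nhd[of _ "{..<t+1}"]) auto
  ultimately show ?thesis
    by (simp add: B_int_def[abs_def] has_real_derivative_iff_has_vector_derivative)
qed

lemma effective_dampingD:
  assumes "effective_damping b"
  shows "\<And>t. 0 \<le> t \<Longrightarrow> (b has_real_derivative deriv0 b t) (at t within {0..})"
    and "continuous_on {0..} (deriv0 b)"
    and "\<And>t. 0 \<le> t \<Longrightarrow> 0 < b t"
    and "\<And>t. 0 \<le> t \<Longrightarrow> (B_int b has_real_derivative 1 / b t) (at t within {0..})"
proof -
  show 1: "\<And>t. 0 \<le> t \<Longrightarrow> (b has_real_derivative deriv0 b t) (at t within {0..})"
    using assms by (auto simp: effective_damping_def C2_half_line_def intro: deriv0_works)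
  show "continuous_on {0..} (deriv0 b)"
    using assms by (auto simp: effective_damping_def C2_half_line_def intro: differentiable_imp_continuous_on)
  show 2: "\<And>t. 0 \<le> t \<Longrightarrow> 0 < b t" using assms by (auto simp: effective_damping_def)
  show "\<And>t. 0 \<le> t \<Longrightarrow> (B_int b has_real_derivative 1 / b t) (at t within {0..})"
    by (rule B_int_deriv[OF _ 2]) (use 1 in \<open>auto intro: DERIV_continuous_on\<close>)
qed

lemma B_int_0: "B_int b 0 = 0"
  by (simp add: B_int_def)

lemma B_int_mono:
  assumes "effective_damping b" "0 \<le> s" "s \<le> t"
  shows "B_int b s \<le> B_int b t"
  by (rule half_line_mono[where f = "B_int b" and a = 0, OF effective_dampingD(4)[OF assms(1)]])
     (use assms effective_dampingD(3)[OF assms(1)] in \<open>auto intro: less_imp_le\<close>)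

text \<open>Since \<open>t b(t)\<close> tends to infinity and \<open>b\<close> is positive on
  compact intervals, \<open>b(t) (1 + t)\<close> is bounded below, which turns the symbol bound into
  \<open>\<bar>b'\<bar> \<le> C b^2\<close>. Then
  \<open>(1/b^2)' = -2 b' / b^3 \<le> 2 C / b = 2 C B'\<close>, and comparing increments gives the
  second bound.\<close>

lemma effective_damping_bounds:
  assumes b: "effective_damping b"
  obtains C where "C > 0" "\<And>t. 0 \<le> t \<Longrightarrow> \<bar>deriv0 b t\<bar> \<le> C * (b t)\<^sup>2"
    "\<And>t. 0 \<le> t \<Longrightarrow> 1 / (b t)\<^sup>2 \<le> C * (1 + B_int b t)"
proof -
  note bd = effective_dampingD(1)[OF b] and bpos = effective_dampingD(3)[OF b] and Bd = effective_dampingD(4)[OF b]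
  obtain C1 where C1: "C1 > 0" "\<And>t. 0 \<le> t \<Longrightarrow> \<bar>deriv0 b t\<bar> \<le> C1 * b t / (1 + t)"
    using b unfolding effective_damping_def symbol_bounds_def by blast
  have "filterlim (\<lambda>t. t * b t) at_top at_top" using b by (simp add: effective_damping_def)
  then obtain N where N: "\<And>t. N \<le> t \<Longrightarrow> 1 \<le> t * b t"
    unfolding filterlim_at_top eventually_at_top_linorder by blast
  have "continuous_on {0..max 0 N} b"
    by (rule continuous_on_subset[of "{0..}"]) (use bd in \<open>auto intro: DERIV_continuous_on\<close>)
  then obtain t0 where t0: "t0 \<in> {0..max 0 N}" "\<And>t. t \<in> {0..max 0 N} \<Longrightarrow> b t0 \<le> b t"
    using continuous_attains_inf[of "{0..max 0 N}" b] by auto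
  \<comment> \<open>1 serves for \<open>t > N\<close>, the minimum \<open>b t0\<close> of
    \<open>b\<close> over \<open>{0..max 0 N}\<close> for \<open>t \<le> N\<close>.\<close>
  define c where "c = min 1 (b t0)"
  have c: "0 < c" using t0(1) bpos[of t0] by (simp add: c_def)
  have cb: "c \<le> b t * (1 + t)" if t: "0 \<le> t" for t
  proof (cases "t \<le> N")
    case True
    then have "b t0 \<le> b t" using t by (intro t0) auto
    moreover have "0 \<le> b t * t" using bpos[OF t] t by simp
    ultimately show ?thesis by (simp add: c_def algebra_simps)
  next
    case False
    then have "1 \<le> t * b t" by (intro N) simp
    then show ?thesis using bpos[OF t] unfolding c_def distrib_left by (simp add: mult.commute)
  qed
  define C2 where "C2 = C1 / c"
  have C2: "0 < C2" using C1 c by (simp add: C2_def)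
  have b': "\<bar>deriv0 b t\<bar> \<le> C2 * (b t)\<^sup>2" if t: "0 \<le> t" for t
  proof -
    have "C1 * b t / (1 + t) \<le> C2 * (b t)\<^sup>2"
      using mult_right_mono[OF cb[OF t], of "C1 * b t"] c C1(1) t bpos[OF t]
      by (simp add: C2_def field_simps power2_eq_square)
    then show ?thesis using C1(2)[OF t] by linarith
  qed
  have inv: "1 / (b t)\<^sup>2 \<le> 2 * C2 * B_int b t + 1 / (b 0)\<^sup>2" if t: "0 \<le> t" for t
  proof -
    let ?f = "\<lambda>t. 2 * C2 * B_int b t - 1 / (b t)\<^sup>2"
    have "?f 0 \<le> ?f t"
    proof (rule half_line_mono[where a = 0 and f = ?f])
      fix x :: real assume x: "0 \<le> x"
      note bx = bpos[OF x]
      show "(?f has_real_derivative 2 * C2 * (1 / b x) + 2 * deriv0 b x / (b x)^3) (at x within {0..})"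
        using bx by (auto intro!: derivative_eq_intros bd[OF x] Bd[OF x] simp: field_simps eval_nat_numeral)
      have "- (C2 * (b x)\<^sup>2) \<le> deriv0 b x" using b'[OF x] by linarith
      then have "- (C2 * (b x)\<^sup>2) / (b x)^3 \<le> deriv0 b x / (b x)^3"
        using bx by (intro divide_right_mono) auto
      moreover have "- (C2 * (b x)\<^sup>2) / (b x)^3 = - (C2 * (1 / b x))"
        using bx by (simp add: field_simps eval_nat_numeral)
      ultimately show "0 \<le> 2 * C2 * (1 / b x) + 2 * deriv0 b x / (b x)^3" by simp
    qed (use t in auto)
    then show ?thesis by (simp add: B_int_0)
  qed
  let ?C = "2 * C2 + 1 / (b 0)\<^sup>2"
  have b0: "0 < 1 / (b 0)\<^sup>2" using bpos[of 0] by simp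
  show ?thesis
  proof (rule that[of ?C])
    show "0 < ?C" using C2 b0 by linarith
    fix t :: real assume t: "0 \<le> t"
    have "C2 * (b t)\<^sup>2 \<le> ?C * (b t)\<^sup>2" using C2 b0 by (intro mult_right_mono) (linarith | simp)+
    then show "\<bar>deriv0 b t\<bar> \<le> ?C * (b t)\<^sup>2" using b'[OF t] by linarith
    have B: "0 \<le> B_int b t" using B_int_mono[OF b order_refl t] by (simp add: B_int_0)
    have "2 * C2 * x + d \<le> (2 * C2 + d) * (1 + x)" if "0 < d" "0 \<le> x" for d x :: real
      using that C2 mult_nonneg_nonneg[of d x] by (simp add: algebra_simps)
    from this[OF b0 B] have "2 * C2 * B_int b t + 1 / (b 0)\<^sup>2 \<le> ?C * (1 + B_int b t)" .
    with inv[OF t] show "1 / (b t)\<^sup>2 \<le> ?C * (1 + B_int b t)" by (rule order_trans)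
  qed
qed

text \<open>The condition \<open>t b' \<le> a0 b\<close> with \<open>a0 < 1\<close> makes
  \<open>b(t) / t\<close> nonincreasing from \<open>t = 1\<close> on, so
  \<open>b(t) \<le> b(1) t\<close> and \<open>B\<close> grows at least like
  \<open>ln t / b(1)\<close>. This justifies the convention
  \<open>B(\<infinity>) = \<infinity>\<close>.\<close>

lemma B_int_unbounded:
  assumes b: "effective_damping b"
  shows "\<exists>t\<ge>0. M \<le> B_int b t"
proof -
  note bd = effective_dampingD(1)[OF b] and bpos = effective_dampingD(3)[OF b] and Bd = effective_dampingD(4)[OF b]
  obtain a0 where a0: "a0 < 1" "\<And>t. 0 \<le> t \<Longrightarrow> t * deriv0 b t \<le> a0 * b t"
    using b unfolding effective_damping_def by blast
  have b1: "0 < b 1" by (simp add: bpos)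
  have lin: "b t \<le> b 1 * t" if t: "1 \<le> t" for t
  proof -
    have "- (b 1 / 1) \<le> - (b t / t)"
    proof (rule half_line_mono[where a = 1 and f = "\<lambda>t. - (b t / t)"])
      fix x :: real assume x: "1 \<le> x"
      show "((\<lambda>t. - (b t / t)) has_real_derivative (b x - x * deriv0 b x) / x\<^sup>2) (at x within {0..})"
        using x by (auto intro!: derivative_eq_intros bd simp: field_simps power2_eq_square)
      have "a0 * b x \<le> 1 * b x" using a0 bpos[of x] x by (intro mult_right_mono) auto
      then show "0 \<le> (b x - x * deriv0 b x) / x\<^sup>2" using a0(2)[of x] x by simp
    qed (use t in auto)
    then show ?thesis using t by (simp add: field_simps)
  qed
  have log: "ln t \<le> b 1 * B_int b t" if t: "1 \<le> t" for t
  proof -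
    have "b 1 * B_int b 1 - ln 1 \<le> b 1 * B_int b t - ln t"
    proof (rule half_line_mono[where a = 1 and f = "\<lambda>t. b 1 * B_int b t - ln t"])
      fix x :: real assume x: "1 \<le> x"
      show "((\<lambda>t. b 1 * B_int b t - ln t) has_real_derivative b 1 * (1 / b x) - 1 / x) (at x within {0..})"
        using x by (auto intro!: derivative_eq_intros Bd)
      show "0 \<le> b 1 * (1 / b x) - 1 / x" using lin[OF x] x bpos[of x] by (simp add: field_simps)
    qed (use t in auto)
    moreover have "0 \<le> b 1 * B_int b 1" using b1 B_int_mono[OF b, of 0 1] by (simp add: B_int_0)
    ultimately show ?thesis by simp
  qed
  \<comment> \<open>The maximum with 0 keeps the witness at least 1, where the logarithmic bound
    holds.\<close>
  let ?t = "exp (max 0 (b 1 * M))"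
  have "b 1 * M \<le> b 1 * B_int b ?t" using log[of ?t] by simp
  then have "M \<le> B_int b ?t" using b1 by simp
  then show ?thesis by (intro exI[of _ ?t]) auto
qed

text \<open>Comparing real suprema takes a nonempty, bounded set: \<open>t = r = T0\<close> provides
  an element and \<open>mass_balance\<close> the bound. That element is nonnegative by the
  truncation at 0, hence so is the supremum.\<close>

lemma Omega_mono:
  assumes b: "effective_damping b" and mb: "mass_balance b m \<beta> T0" and L: "0 \<le> L" "L \<le> L'"
  shows "Omega b m \<beta> T0 L \<le> Omega b m \<beta> T0 L'" and "0 \<le> Omega b m \<beta> T0 L"
proof -
  have T0: "0 \<le> T0" using mb by (simp add: mass_balance_def)
  then have "0 \<le> B_int b T0" using B_int_mono[OF b, of 0 T0] by (simp add: B_int_0)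
  then have X: "ln (X_ratio b T0 T0) = 0" by (simp add: X_ratio_def)
  have bdd: "bdd_above (excess_set b m \<beta> T0 L)" "bdd_above (excess_set b m \<beta> T0 L')"
    using mb L by (auto simp: mass_balance_def)
  have el: "max (Q_int b m T0 T0 - \<beta> * ln (X_ratio b T0 T0)) 0 \<in> excess_set b m \<beta> T0 L"
    unfolding excess_set_def
    by (intro CollectI exI[of _ T0] conjI refl order_refl) (use X L in simp)
  show "Omega b m \<beta> T0 L \<le> Omega b m \<beta> T0 L'"
    unfolding Omega_def
  proof (rule cSup_subset_mono)
    show "excess_set b m \<beta> T0 L \<subseteq> excess_set b m \<beta> T0 L'"
      unfolding excess_set_def using L by force
  qed (use el bdd in auto)
  show "0 \<le> Omega b m \<beta> T0 L"
    unfolding Omega_def by (rule order_trans[OF _ cSup_upper[OF el bdd(1)]]) simp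
qed

text \<open>The estimates of the locale for the concrete coefficients, with \<open>G\<close>
  rewritten as \<open>K R^(-\<kappa>) exp(\<Omega>(log R))\<close>. \<open>K\<close> and
  \<open>R0\<close> precede \<open>\<epsilon>\<close>, \<open>T\<close> and \<open>u\<close>, a
  uniformity that the lifespan bounds need; beyond \<open>R0\<close> the data term exceeds
  \<open>J0 / 2\<close>.\<close>

lemma doubling_estimates:
  fixes f g :: "real ^ 'n \<Rightarrow> real"
  assumes p: "p > 1" and b: "effective_damping b" and mb: "mass_balance b m \<beta> T0"
    and sol: "slow_adjoint_solution b m \<beta> T0 \<rho>"
    and f: "integrable lebesgue f" and g: "integrable lebesgue g" and J: "J0 b \<rho> f g > 0"
  defines "\<kappa> \<equiv> 1 / (p - 1) - real CARD('n) / 2 - \<beta>"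
  obtains K R0 where "0 < K" "2 \<le> R0"
    "\<And>\<epsilon> T (u :: real \<times> (real ^ 'n) \<Rightarrow> real). 0 < \<epsilon> \<Longrightarrow> weak_solution b m f g p \<epsilon> T u \<Longrightarrow>
      \<exists>A :: real \<Rightarrow> real. (\<forall>R. 0 \<le> A R) \<and>
        (\<forall>R t. R0 \<le> R \<longrightarrow> 0 \<le> t \<longrightarrow> ereal t < T \<longrightarrow> R \<le> 1 + B_int b t \<longrightarrow>
           A (R/2) \<le> A R \<and>
           (\<forall>l>0. A (R/2) + \<epsilon> * (J0 b \<rho> f g / 2) \<le> l * (A R - A (R/2))
               + l powr (- 1 / (p - 1)) * (K * R powr (- \<kappa>) * exp (Omega b m \<beta> T0 (ln R)))) \<and>
           A (R/2) / 2 + \<epsilon> * (J0 b \<rho> f g / 2)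
             \<le> 2 powr (1 / (p - 1)) * (K * R powr (- \<kappa>) * exp (Omega b m \<beta> T0 (ln R))))"
proof -
  have \<beta>: "0 \<le> \<beta>" using mb by (simp add: mass_balance_def)
  have C2: "C2_half_line \<rho>" using sol by (simp add: slow_adjoint_solution_def)
  obtain Cr where Cr: "Cr > 0" "\<And>t. 0 \<le> t \<Longrightarrow> \<rho> t > 0" "\<And>t. 0 \<le> t \<Longrightarrow> \<bar>deriv0 \<rho> t\<bar> \<le> Cr * b t * \<rho> t"
    "\<And>t. 0 \<le> t \<Longrightarrow> b t * \<rho> t \<le> Cr * (1 + B_int b t) powr \<beta> * exp (Omega b m \<beta> T0 (ln (1 + B_int b t)))"
    using sol unfolding slow_adjoint_solution_def by blast
  obtain Cb where Cb: "Cb > 0" "\<And>t. 0 \<le> t \<Longrightarrow> \<bar>deriv0 b t\<bar> \<le> Cb * (b t)\<^sup>2"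
    "\<And>t. 0 \<le> t \<Longrightarrow> 1 / (b t)\<^sup>2 \<le> Cb * (1 + B_int b t)"
    by (rule effective_damping_bounds[OF b], rule that)
  note bD = effective_dampingD[OF b]
  have Bn: "0 \<le> B_int b t" if "0 \<le> t" for t
    using B_int_mono[OF b order_refl that] by (simp add: B_int_0)
  obtain H H1 H2 :: "real \<Rightarrow> real" and ch :: real where H:
    "\<And>s. (H has_real_derivative H1 s) (at s)"
    "\<And>s. (H1 has_real_derivative H2 s) (at s)"
    "continuous_on UNIV H2"
    "\<And>s. s \<le> 1/2 \<Longrightarrow> H s = 1" "\<And>s. 1 \<le> s \<Longrightarrow> H s = 0"
    "\<And>s. 0 \<le> H s" "\<And>s. H s \<le> 1"
    "\<And>s. s \<le> 1/2 \<or> 1 \<le> s \<Longrightarrow> H1 s = 0" "\<And>s. s \<le> 1/2 \<or> 1 \<le> s \<Longrightarrow> H2 s = 0"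
    "\<And>s. \<bar>H1 s\<bar> \<le> ch * H s powr (1/p)" "\<And>s. \<bar>H2 s\<bar> \<le> ch * H s powr (1/p)"
    "ch > 0"
    by (rule cutoff_exists[OF p], rule that)
  have rd: "(\<rho> has_real_derivative deriv0 \<rho> t) (at t within {0..})"
       "(deriv0 \<rho> has_real_derivative deriv0 (deriv0 \<rho>) t) (at t within {0..})" if "0 \<le> t" for t
    using C2 that by (auto simp: C2_half_line_def intro: deriv0_works)
  have ode: "deriv0 (deriv0 \<rho>) t - (deriv0 b t * \<rho> t + b t * deriv0 \<rho> t) + (m t)\<^sup>2 * \<rho> t = 0" if t: "0 \<le> t" for t
  proof -
    have "deriv0 (\<lambda>s. b s * \<rho> s) t = deriv0 b t * \<rho> t + deriv0 \<rho> t * b t"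
      by (intro deriv0_eq DERIV_mult bD rd t)
    moreover have "deriv0 (deriv0 \<rho>) t - deriv0 (\<lambda>s. b s * \<rho> s) t + (m t)\<^sup>2 * \<rho> t = 0"
      using sol t unfolding slow_adjoint_solution_def by blast
    ultimately show ?thesis by (simp only: mult.commute[of "deriv0 \<rho> t"])
  qed
  let ?C = "max Cr Cb"
  interpret liouville_cutoff p H H1 H2 ch b "deriv0 b" \<rho> "deriv0 \<rho>" "deriv0 (deriv0 \<rho>)" m "B_int b" ?C
  proof
    show "continuous_on {0..} (deriv0 (deriv0 \<rho>))" using C2 by (simp add: C2_half_line_def)
    fix t :: real assume t: "0 \<le> t"
    have "Cr * (b t * \<rho> t) \<le> ?C * (b t * \<rho> t)" "Cb * (b t)\<^sup>2 \<le> ?C * (b t)\<^sup>2"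
      "Cb * (1 + B_int b t) \<le> ?C * (1 + B_int b t)"
      using bD(3)[OF t] Cr(2)[OF t] Bn[OF t] by (auto intro!: mult_right_mono)
    then show "\<bar>deriv0 \<rho> t\<bar> \<le> ?C * b t * \<rho> t" "\<bar>deriv0 b t\<bar> \<le> ?C * (b t)\<^sup>2"
      "1 / (b t)\<^sup>2 \<le> ?C * (1 + B_int b t)"
      using Cr(3)[OF t] Cb(2,3)[OF t] by (simp_all add: mult.assoc del: max.bounded_iff)
  qed (fact p H bD rd Cr(2) ode B_int_0 | use Cr(1) in simp)+
  define Mc where "Mc = ch * (4 * ?C + 5 + 2 * real CARD('n))"
  have Mc: "0 < Mc" using H(12) Cr(1) by (simp add: Mc_def add_pos_pos)
  define K where "K = Mc powr (p / (p - 1)) * unit_ball_vol (real CARD('n)) * Cr"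
  have K: "0 < K" using Mc Cr(1) by (simp add: K_def)
  have "(data_term f g \<longlongrightarrow> J0 b \<rho> f g) at_top"
    unfolding J0_def by (rule data_term_tendsto[OF f g])
  then have "\<forall>\<^sub>F R in at_top. J0 b \<rho> f g / 2 < data_term f g R"
    by (rule order_tendstoD) (use J in simp)
  then obtain R1 where R1: "\<And>R. R1 \<le> R \<Longrightarrow> J0 b \<rho> f g / 2 < data_term f g R"
    unfolding eventually_at_top_linorder by blast
  show ?thesis
  proof (rule that[of K "max 2 R1"])
    fix \<epsilon> T and u :: "real \<times> (real ^ 'n) \<Rightarrow> real"
    assume e: "0 < \<epsilon>" and weak: "weak_solution b m f g p \<epsilon> T u"
    have goal: "mass_in u (R/2) \<le> mass_in u R \<and>
           (\<forall>l>0. mass_in u (R/2) + \<epsilon> * (J0 b \<rho> f g / 2) \<le> l * (mass_in u R - mass_in u (R/2))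
               + l powr (- 1 / (p - 1)) * (K * R powr (- \<kappa>) * exp (Omega b m \<beta> T0 (ln R)))) \<and>
           mass_in u (R/2) / 2 + \<epsilon> * (J0 b \<rho> f g / 2)
             \<le> 2 powr (1 / (p - 1)) * (K * R powr (- \<kappa>) * exp (Omega b m \<beta> T0 (ln R)))"
      if R: "max 2 R1 \<le> R" and t: "0 \<le> t" "ereal t < T" "R \<le> 1 + B_int b t" for R t
    proof -
      obtain s where s: "0 \<le> s" "s \<le> t" "R = 1 + B_int b s"
        using B_attains[OF t(1) _ t(3)] R by auto
      have sT: "ereal s < T" using s(2) t(2) by (auto intro: le_less_trans[of _ "ereal t"])
      \<comment> \<open>The given bound on \<open>b \<rho>\<close> is nondecreasing in time, as
        \<open>B\<close> and \<open>Omega\<close> are monotone and \<open>\<beta> \<ge> 0\<close>,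
        so its value at time \<open>s\<close> serves on all of \<open>[0,s]\<close>.\<close>
      define E where "E = Cr * R powr \<beta> * exp (Omega b m \<beta> T0 (ln R))"
      have E: "b r * \<rho> r \<le> E" if r: "0 \<le> r" "r \<le> s" for r
      proof -
        have Br: "0 \<le> B_int b r" "1 + B_int b r \<le> R" using Bn[OF r(1)] B_int_mono[OF b r] s(3) by auto
        then have "(1 + B_int b r) powr \<beta> \<le> R powr \<beta>" using \<beta> by (intro powr_mono2) auto
        moreover have "Omega b m \<beta> T0 (ln (1 + B_int b r)) \<le> Omega b m \<beta> T0 (ln R)"
          using Br by (intro Omega_mono[OF b mb]) auto
        ultimately have "Cr * (1 + B_int b r) powr \<beta> * exp (Omega b m \<beta> T0 (ln (1 + B_int b r))) \<le> E"
          unfolding E_def using Cr(1) by (intro mult_mono) auto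
        then show ?thesis using Cr(4)[OF r(1)] by linarith
      qed
      have R0: "0 < R" using R by simp
      have "(Mc / R) powr (p / (p - 1)) * (unit_ball_vol (real CARD('n)) * E * R powr (real CARD('n) / 2 + 1))
         = K * (R powr (- (p / (p - 1))) * R powr \<beta> * R powr (real CARD('n) / 2 + 1)) * exp (Omega b m \<beta> T0 (ln R))"
        using R0 Mc by (simp add: K_def E_def powr_divide powr_minus_divide)
      \<comment> \<open>The exponents add up to
        \<open>- 1 - 1/(p-1) + \<beta> + n/2 + 1 = - \<kappa>\<close>.\<close>
      also have "R powr (- (p / (p - 1))) * R powr \<beta> * R powr (real CARD('n) / 2 + 1) = R powr (- \<kappa>)"
      proof -
        have "p / (p - 1) = 1 + 1 / (p - 1)" using p by (simp add: field_simps)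
        then show ?thesis unfolding powr_add[symmetric] \<kappa>_def by (simp add: algebra_simps)
      qed
      finally have G: "(Mc / R) powr (p / (p - 1)) * (unit_ball_vol (real CARD('n)) * E * R powr (real CARD('n) / 2 + 1))
         = K * R powr (- \<kappa>) * exp (Omega b m \<beta> T0 (ln R))" .
      note est = weak_estimate[OF weak s(1) sT s(3), of E, folded Mc_def, unfolded G]
      have d: "\<epsilon> * (J0 b \<rho> f g / 2) \<le> \<epsilon> * data_term f g R"
        using e R1[of R] R by (intro mult_left_mono) auto
      show ?thesis
        using est(1)[OF E] est(2)[OF E] est(3)[OF E] d by (force intro: order_trans[rotated])
    qed
    then show "\<exists>A :: real \<Rightarrow> real. (\<forall>R. 0 \<le> A R) \<and>
        (\<forall>R t. max 2 R1 \<le> R \<longrightarrow> 0 \<le> t \<longrightarrow> ereal t < T \<longrightarrow> R \<le> 1 + B_int b t \<longrightarrow>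
           A (R/2) \<le> A R \<and>
           (\<forall>l>0. A (R/2) + \<epsilon> * (J0 b \<rho> f g / 2) \<le> l * (A R - A (R/2))
               + l powr (- 1 / (p - 1)) * (K * R powr (- \<kappa>) * exp (Omega b m \<beta> T0 (ln R)))) \<and>
           A (R/2) / 2 + \<epsilon> * (J0 b \<rho> f g / 2)
             \<le> 2 powr (1 / (p - 1)) * (K * R powr (- \<kappa>) * exp (Omega b m \<beta> T0 (ln R))))"
      by (intro exI[of _ "mass_in u"] conjI allI impI mass_in_nonneg) blast+
  qed (use K in auto)
qed

section \<open>Nonexistence and lifespan\<close>

text \<open>Each side says how \<open>2 / (p - 1)\<close> compares with
  \<open>n + 2 \<beta>\<close>, which is positive since \<open>n > 0\<close>.\<close>

lemma p_crit_iff: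
  assumes "p > 1" "0 \<le> \<beta>" "0 < n"
  shows "p < p_crit n \<beta> \<longleftrightarrow> 0 < 1 / (p - 1) - real n / 2 - \<beta>"
    and "p = p_crit n \<beta> \<longleftrightarrow> 1 / (p - 1) - real n / 2 - \<beta> = 0"
proof -
  have "0 < real n + 2 * \<beta>" using assms by simp
  then show "p < p_crit n \<beta> \<longleftrightarrow> 0 < 1 / (p - 1) - real n / 2 - \<beta>"
    "p = p_crit n \<beta> \<longleftrightarrow> 1 / (p - 1) - real n / 2 - \<beta> = 0"
    using assms(1) by (auto simp: p_crit_def field_simps)
qed

text \<open>For finite \<open>T\<close> the bound passes to the endpoint by left continuity of
  \<open>B\<close>. For \<open>T = \<infinity>\<close> it contradicts the unboundedness of
  \<open>B\<close>, so a finite bound entails \<open>T < \<infinity>\<close>.\<close>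

lemma B_ext_le:
  assumes b: "effective_damping b" and T: "0 < T"
    and le: "\<And>t. 0 \<le> t \<Longrightarrow> ereal t < T \<Longrightarrow> 1 + B_int b t \<le> c"
  shows "1 + B_ext b T \<le> ereal c"
proof (cases T)
  case (real r)
  have r: "0 < r" using T real by simp
  have "1 + B_int b r \<le> c"
  proof (rule tendsto_upperbound)
    have "continuous_on {0..} (B_int b)"
      by (rule DERIV_continuous_on, rule effective_dampingD(4)[OF b]) simp
    then have "(B_int b \<longlongrightarrow> B_int b r) (at r within {0..})"
      using r by (simp add: continuous_on_def)
    then have "(B_int b \<longlongrightarrow> B_int b r) (at r within {0..<r})"
      by (rule tendsto_within_subset) auto
    moreover have "at r within {0..<r} = at_left r"
      by (rule at_within_nhd[of _ "{0<..}"]) (use r in auto)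
    ultimately show "((\<lambda>t. 1 + B_int b t) \<longlongrightarrow> 1 + B_int b r) (at_left r)"
      by (auto intro: tendsto_intros)
    show "\<forall>\<^sub>F t in at_left r. 1 + B_int b t \<le> c"
      using eventually_at_left_real[OF r] by eventually_elim (use le real in auto)
  qed simp
  then show ?thesis using real by (simp add: B_ext_def one_ereal_def)
next
  case PInf
  obtain t where "0 \<le> t" "c \<le> B_int b t" using B_int_unbounded[OF b] by blast
  then show ?thesis using le[of t] PInf by simp
qed (use T in simp)

context
  fixes b m \<rho> :: "real \<Rightarrow> real" and \<beta> T0 p :: real and f g :: "real ^ 'n \<Rightarrow> real"
  assumes p: "p > 1" and b: "effective_damping b" and mb: "mass_balance b m \<beta> T0"
    and sol: "slow_adjoint_solution b m \<beta> T0 \<rho>"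
    and f: "integrable lebesgue f" and g: "integrable lebesgue g" and J: "J0 b \<rho> f g > 0"
begin

text \<open>The last doubling estimate with the nonnegative term \<open>A (R/2) / 2\<close>
  dropped.\<close>

lemma subcritical_estimate:
  defines "\<kappa> \<equiv> 1 / (p - 1) - real CARD('n) / 2 - \<beta>"
  obtains K R0 where "0 < K" "2 \<le> R0"
    "\<And>\<epsilon> T (u :: real \<times> (real ^ 'n) \<Rightarrow> real) R t. 0 < \<epsilon> \<Longrightarrow> weak_solution b m f g p \<epsilon> T u \<Longrightarrow>
      R0 \<le> R \<Longrightarrow> 0 \<le> t \<Longrightarrow> ereal t < T \<Longrightarrow> R \<le> 1 + B_int b t \<Longrightarrow>
      \<epsilon> \<le> K * R powr (- \<kappa>) * exp (Omega b m \<beta> T0 (ln R))"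
proof -
  obtain K R0 where K: "0 < K" "2 \<le> R0"
    "\<And>\<epsilon> T (u :: real \<times> (real ^ 'n) \<Rightarrow> real). 0 < \<epsilon> \<Longrightarrow> weak_solution b m f g p \<epsilon> T u \<Longrightarrow>
      \<exists>A :: real \<Rightarrow> real. (\<forall>R. 0 \<le> A R) \<and>
        (\<forall>R t. R0 \<le> R \<longrightarrow> 0 \<le> t \<longrightarrow> ereal t < T \<longrightarrow> R \<le> 1 + B_int b t \<longrightarrow>
           A (R/2) \<le> A R \<and>
           (\<forall>l>0. A (R/2) + \<epsilon> * (J0 b \<rho> f g / 2) \<le> l * (A R - A (R/2))
               + l powr (- 1 / (p - 1)) * (K * R powr (- \<kappa>) * exp (Omega b m \<beta> T0 (ln R)))) \<and>
           A (R/2) / 2 + \<epsilon> * (J0 b \<rho> f g / 2)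
             \<le> 2 powr (1 / (p - 1)) * (K * R powr (- \<kappa>) * exp (Omega b m \<beta> T0 (ln R))))"
    by (rule doubling_estimates[OF p b mb sol f g J, folded \<kappa>_def], rule that)
  let ?j = "J0 b \<rho> f g / 2"
  show ?thesis
  proof (rule that[of "2 powr (1 / (p - 1)) * K / ?j" R0])
    show "0 < 2 powr (1 / (p - 1)) * K / ?j" using K J by simp
    fix \<epsilon> T R t and u :: "real \<times> (real ^ 'n) \<Rightarrow> real"
    assume *: "0 < \<epsilon>" "weak_solution b m f g p \<epsilon> T u" "R0 \<le> R" "0 \<le> t" "ereal t < T" "R \<le> 1 + B_int b t"
    from K(3)[OF *(1,2)] *(3-6) obtain A :: "real \<Rightarrow> real" where
      "0 \<le> A (R/2)" "A (R/2) / 2 + \<epsilon> * ?j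
             \<le> 2 powr (1 / (p - 1)) * (K * R powr (- \<kappa>) * exp (Omega b m \<beta> T0 (ln R)))" by blast
    then have "\<epsilon> * ?j \<le> 2 powr (1 / (p - 1)) * (K * R powr (- \<kappa>) * exp (Omega b m \<beta> T0 (ln R)))" by linarith
    then show "\<epsilon> \<le> 2 powr (1 / (p - 1)) * K / ?j * R powr (- \<kappa>) * exp (Omega b m \<beta> T0 (ln R))"
      using J by (simp add: field_simps)
  qed (use K(1,2) in auto)
qed

text \<open>At \<open>\<kappa> = 0\<close> the power of \<open>R\<close> disappears, and along
  \<open>R = R0 * 2 ^ i\<close> the mass plus the data term satisfies the hypotheses of
  \<open>sum_power_deficit\<close>. The sequence starts at or above
  \<open>\<epsilon> J0 / 2\<close>, whence the factor
  \<open>\<epsilon> powr (1 - p)\<close>.\<close>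

lemma critical_sum_estimate:
  assumes crit: "1 / (p - 1) - real CARD('n) / 2 - \<beta> = 0"
  obtains K R0 where "0 < K" "2 \<le> R0"
    "\<And>\<epsilon> T (u :: real \<times> (real ^ 'n) \<Rightarrow> real) N. 0 < \<epsilon> \<Longrightarrow> weak_solution b m f g p \<epsilon> T u \<Longrightarrow>
      \<forall>i<N. \<exists>t\<ge>0. ereal t < T \<and> R0 * 2 ^ i \<le> 1 + B_int b t \<Longrightarrow>
      (\<Sum>i<N. exp (- (p - 1) * Omega b m \<beta> T0 (ln R0 + real i * ln 2))) \<le> K * \<epsilon> powr (1 - p)"
proof -
  obtain K R0 where K: "0 < K" "2 \<le> R0"
    "\<And>\<epsilon> T (u :: real \<times> (real ^ 'n) \<Rightarrow> real). 0 < \<epsilon> \<Longrightarrow> weak_solution b m f g p \<epsilon> T u \<Longrightarrow>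
      \<exists>A :: real \<Rightarrow> real. (\<forall>R. 0 \<le> A R) \<and>
        (\<forall>R t. R0 \<le> R \<longrightarrow> 0 \<le> t \<longrightarrow> ereal t < T \<longrightarrow> R \<le> 1 + B_int b t \<longrightarrow>
           A (R/2) \<le> A R \<and>
           (\<forall>l>0. A (R/2) + \<epsilon> * (J0 b \<rho> f g / 2) \<le> l * (A R - A (R/2))
               + l powr (- 1 / (p - 1)) * (K * R powr (- 0) * exp (Omega b m \<beta> T0 (ln R)))) \<and>
           A (R/2) / 2 + \<epsilon> * (J0 b \<rho> f g / 2)
             \<le> 2 powr (1 / (p - 1)) * (K * R powr (- 0) * exp (Omega b m \<beta> T0 (ln R))))"
    by (rule doubling_estimates[OF p b mb sol f g J, unfolded crit], rule that)
  let ?j = "J0 b \<rho> f g / 2"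
  \<comment> \<open>Twice the bound on \<open>A (R/2) / 2 + \<epsilon> J0 / 2\<close> bounds
    \<open>A (R/2) + \<epsilon> J0 / 2\<close>, which fixes the a priori constant.\<close>
  define Kap where "Kap = 2 * 2 powr (1 / (p - 1))"
  have Kap: "0 < Kap" by (simp add: Kap_def)
  define c where "c = min ((p - 1) / 4 powr p) ((1 - 2 powr (1 - p)) * Kap powr (1 - p))"
  have "(2::real) powr (1 - p) < 2 powr 0" using p by (intro powr_less_mono) auto
  then have c: "0 < c" using p Kap by (simp add: c_def)
  show ?thesis
  proof (rule that[of "?j powr (1 - p) / (c * K powr (1 - p))" R0])
    show "0 < ?j powr (1 - p) / (c * K powr (1 - p))" using J c K(1) by simp
    fix \<epsilon> T N and u :: "real \<times> (real ^ 'n) \<Rightarrow> real"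
    assume e: "0 < \<epsilon>" and weak: "weak_solution b m f g p \<epsilon> T u"
      and N: "\<forall>i<N. \<exists>t\<ge>0. ereal t < T \<and> R0 * 2 ^ i \<le> 1 + B_int b t"
    define R where "R i = R0 * 2 ^ i" for i :: nat
    define G where "G i = K * exp (Omega b m \<beta> T0 (ln (R i)))" for i
    have Rpos: "0 < R i" "R0 \<le> R i" for i using K(2) by (auto simp: R_def)
    obtain A :: "real \<Rightarrow> real" where A0: "\<And>r. 0 \<le> A r" and A:
      "\<And>r t. R0 \<le> r \<Longrightarrow> 0 \<le> t \<Longrightarrow> ereal t < T \<Longrightarrow> r \<le> 1 + B_int b t \<Longrightarrow>
           A (r/2) \<le> A r \<and>
           (\<forall>l>0. A (r/2) + \<epsilon> * ?j \<le> l * (A r - A (r/2))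
               + l powr (- 1 / (p - 1)) * (K * r powr (- 0) * exp (Omega b m \<beta> T0 (ln r)))) \<and>
           A (r/2) / 2 + \<epsilon> * ?j
             \<le> 2 powr (1 / (p - 1)) * (K * r powr (- 0) * exp (Omega b m \<beta> T0 (ln r)))"
      using K(3)[OF e weak] by blast
    have A': "A (R i / 2) \<le> A (R i) \<and>
           (\<forall>l>0. A (R i / 2) + \<epsilon> * ?j \<le> l * (A (R i) - A (R i / 2)) + l powr (- 1 / (p - 1)) * G i) \<and>
           A (R i / 2) / 2 + \<epsilon> * ?j \<le> 2 powr (1 / (p - 1)) * G i" if i: "i < N" for i
    proof -
      obtain t where t: "0 \<le> t" "ereal t < T" "R i \<le> 1 + B_int b t" using N i by (auto simp: R_def)
      \<comment> \<open>Positivity matters because \<open>0 powr 0\<close> is 0.\<close>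
      have "R i powr (- 0) = 1" using Rpos(1)[of i] by simp
      then show ?thesis using A[OF Rpos(2) t] unfolding G_def by simp
    qed
    \<comment> \<open>Taken at half the radius, so that \<open>Z (Suc i)\<close> involves
      \<open>A (R i)\<close> and consecutive terms are linked by one doubling.\<close>
    define Z where "Z i = A (R i / 2) + \<epsilon> * ?j" for i
    have ZS: "Z (Suc i) = A (R i) + \<epsilon> * ?j" for i by (simp add: Z_def R_def)
    have ej: "0 < \<epsilon> * ?j" using e J by simp
    have "c * (\<Sum>i<N. G i powr (1 - p)) \<le> (\<epsilon> * ?j) powr (1 - p)"
      unfolding c_def
    proof (rule sum_power_deficit[where Z = Z, OF p Kap ej])
      show "\<epsilon> * ?j \<le> Z 0" using A0 by (simp add: Z_def)
      fix i assume i: "i < N"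
      note Ai = A'[OF i]
      show "Z i \<le> Z (Suc i)" using Ai unfolding ZS by (simp add: Z_def)
      show "0 < G i" using K(1) by (simp add: G_def)
      show "Z i \<le> l * (Z (Suc i) - Z i) + l powr (- 1 / (p - 1)) * G i" if "0 < l" for l
        using Ai that unfolding ZS by (simp add: Z_def)
      have "Z i \<le> 2 * (A (R i / 2) / 2 + \<epsilon> * ?j)" using ej by (simp add: Z_def)
      also have "\<dots> \<le> 2 * (2 powr (1 / (p - 1)) * G i)" using Ai by (intro mult_left_mono) auto
      finally show "Z i \<le> Kap * G i" by (simp add: Kap_def)
    qed
    moreover have "G i powr (1 - p) = K powr (1 - p) * exp (- (p - 1) * Omega b m \<beta> T0 (ln R0 + real i * ln 2))" for i
    proof -
      have "ln (R i) = ln R0 + real i * ln 2"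
        using K(2) by (simp add: R_def ln_mult ln_realpow)
      then show ?thesis using K(1) by (simp add: G_def powr_mult exp_powr_real algebra_simps)
    qed
    moreover have "(\<epsilon> * ?j) powr (1 - p) = ?j powr (1 - p) * \<epsilon> powr (1 - p)"
      by (simp only: powr_mult mult.commute)
    ultimately have bound: "c * K powr (1 - p) * (\<Sum>i<N. exp (- (p - 1) * Omega b m \<beta> T0 (ln R0 + real i * ln 2)))
       \<le> ?j powr (1 - p) * \<epsilon> powr (1 - p)"
      by (simp only: sum_distrib_left[symmetric] mult.assoc)
    have cK: "0 < c * K powr (1 - p)" using c K(1) by simp
    show "(\<Sum>i<N. exp (- (p - 1) * Omega b m \<beta> T0 (ln R0 + real i * ln 2)))
       \<le> ?j powr (1 - p) / (c * K powr (1 - p)) * \<epsilon> powr (1 - p)"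
      unfolding times_divide_eq_left pos_le_divide_eq[OF cK]
      using bound by (simp only: mult.commute[of "sum _ _"])
  qed (use K(1,2) in auto)
qed

text \<open>A global solution allows every large \<open>R = e^L\<close>. Sublinearity gives
  \<open>\<Omega>(L) \<le> \<kappa> L / 2\<close> eventually, so
  \<open>\<epsilon> \<le> K e^(-\<kappa> L / 2)\<close>, and the right side tends to 0.\<close>

lemma no_global_solution_subcritical:
  assumes sub: "((\<lambda>L. Omega b m \<beta> T0 L / L) \<longlongrightarrow> 0) at_top"
    and \<kappa>: "0 < 1 / (p - 1) - real CARD('n) / 2 - \<beta>" and e: "0 < \<epsilon>"
  shows "\<not> global_weak_solution b m f g p \<epsilon> u"
proof
  assume u: "global_weak_solution b m f g p \<epsilon> u"
  define \<kappa> where "\<kappa> = 1 / (p - 1) - real CARD('n) / 2 - \<beta>"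
  have k: "0 < \<kappa>" using \<kappa> by (simp add: \<kappa>_def)
  obtain K R0 where K: "0 < K" "2 \<le> R0"
    "\<And>\<epsilon> T (u :: real \<times> (real ^ 'n) \<Rightarrow> real) R t. 0 < \<epsilon> \<Longrightarrow> weak_solution b m f g p \<epsilon> T u \<Longrightarrow>
      R0 \<le> R \<Longrightarrow> 0 \<le> t \<Longrightarrow> ereal t < T \<Longrightarrow> R \<le> 1 + B_int b t \<Longrightarrow>
      \<epsilon> \<le> K * R powr (- \<kappa>) * exp (Omega b m \<beta> T0 (ln R))"
    by (rule subcritical_estimate[folded \<kappa>_def], rule that)
  have est: "\<epsilon> \<le> K * R powr (- \<kappa>) * exp (Omega b m \<beta> T0 (ln R))" if "R0 \<le> R" for R
  proof -
    obtain t where "0 \<le> t" "R \<le> B_int b t" using B_int_unbounded[OF b] by blast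
    then show ?thesis using that by (intro K(3)[OF e u, of R t]) auto
  qed
  have "\<forall>\<^sub>F L in at_top. Omega b m \<beta> T0 L / L < \<kappa> / 2"
    using order_tendstoD(2)[OF sub, of "\<kappa> / 2"] k by simp
  moreover have "\<forall>\<^sub>F L in at_top. max 1 (ln R0) \<le> L" by (rule eventually_ge_at_top)
  ultimately have "\<forall>\<^sub>F L in at_top. \<epsilon> \<le> K * exp (- (\<kappa> / 2) * L)"
  proof eventually_elim
    case (elim L)
    have L: "0 < L" "ln R0 \<le> L" using elim(2) by auto
    have "R0 \<le> exp L" using L(2) K(2) by (metis exp_le_cancel_iff exp_ln less_le_trans zero_less_numeral)
    then have "\<epsilon> \<le> K * exp L powr (- \<kappa>) * exp (Omega b m \<beta> T0 L)" using est[of "exp L"] by simp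
    also have "\<dots> = K * exp (- \<kappa> * L + Omega b m \<beta> T0 L)"
      by (simp add: exp_powr_real mult_exp_exp algebra_simps)
    also have "\<dots> \<le> K * exp (- (\<kappa> / 2) * L)"
      using elim(1) L K(1) by (simp add: field_simps)
    finally show ?case .
  qed
  moreover have "((\<lambda>L. K * exp (- (\<kappa> / 2) * L)) \<longlongrightarrow> K * 0) at_top"
    using k by (intro tendsto_mult tendsto_const filterlim_compose[OF exp_at_bot]
      filterlim_tendsto_neg_mult_at_bot[OF tendsto_const _ filterlim_ident]) auto
  ultimately have "\<epsilon> \<le> K * 0" by (intro tendsto_lowerbound[where F = at_top]) auto
  then show False using e by simp
qed

text \<open>For a global solution every \<open>N\<close> is admissible, as \<open>B\<close> is
  unbounded, so the sums are bounded uniformly in \<open>N\<close>. Since \<open>\<Omega>\<close> is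
  nondecreasing, the integral is then finite.\<close>

lemma no_global_solution_critical:
  assumes crit: "1 / (p - 1) - real CARD('n) / 2 - \<beta> = 0"
    and inf: "(\<integral>\<^sup>+ L \<in> {0..}. ennreal (exp (- (p - 1) * Omega b m \<beta> T0 L)) \<partial>lborel) = \<infinity>" and e: "0 < \<epsilon>"
  shows "\<not> global_weak_solution b m f g p \<epsilon> u"
proof
  assume u: "global_weak_solution b m f g p \<epsilon> u"
  obtain K R0 where K: "0 < K" "2 \<le> R0"
    "\<And>\<epsilon> T (u :: real \<times> (real ^ 'n) \<Rightarrow> real) N. 0 < \<epsilon> \<Longrightarrow> weak_solution b m f g p \<epsilon> T u \<Longrightarrow>
      \<forall>i<N. \<exists>t\<ge>0. ereal t < T \<and> R0 * 2 ^ i \<le> 1 + B_int b t \<Longrightarrow>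
      (\<Sum>i<N. exp (- (p - 1) * Omega b m \<beta> T0 (ln R0 + real i * ln 2))) \<le> K * \<epsilon> powr (1 - p)"
    by (rule critical_sum_estimate[OF crit], rule that)
  have "(\<integral>\<^sup>+ L \<in> {0..}. ennreal (exp (- (p - 1) * Omega b m \<beta> T0 L)) \<partial>lborel) < \<infinity>"
  proof (rule nn_integral_less_top_of_dyadic_sum)
    show "(\<Sum>i<N. exp (- (p - 1) * Omega b m \<beta> T0 (ln R0 + real i * ln 2))) \<le> K * \<epsilon> powr (1 - p)" for N
    proof (rule K(3)[OF e u], intro allI impI)
      fix i
      obtain t where "0 \<le> t" "R0 * 2 ^ i \<le> B_int b t" using B_int_unbounded[OF b] by blast
      then show "\<exists>t\<ge>0. ereal t < \<infinity> \<and> R0 * 2 ^ i \<le> 1 + B_int b t" by (intro exI[of _ t]) auto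
    qed
    show "exp (- (p - 1) * Omega b m \<beta> T0 y) \<le> exp (- (p - 1) * Omega b m \<beta> T0 x)" if "0 \<le> x" "x \<le> y" for x y
      using Omega_mono(1)[OF b mb that] p by (simp add: mult_left_mono)
  qed (use K(2) in auto)
  then show False unfolding inf by blast
qed

text \<open>With \<open>\<Omega> \<le> W\<close>, the estimate
  \<open>\<epsilon> \<le> K R^(-\<kappa>) e^W\<close> at \<open>R = 1 + B(t)\<close> is solved for
  \<open>R\<close>; the summand \<open>R0\<close> of the constant covers times at which
  \<open>R\<close> is still below \<open>R0\<close>.\<close>

lemma lifespan_subcritical:
  assumes bdd: "bounded (Omega b m \<beta> T0 ` {0..})"
    and \<kappa>: "0 < 1 / (p - 1) - real CARD('n) / 2 - \<beta>"
  obtains C where "0 < C"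
    "\<And>\<epsilon> T (u :: real \<times> (real ^ 'n) \<Rightarrow> real) t. 0 < \<epsilon> \<Longrightarrow> weak_solution b m f g p \<epsilon> T u \<Longrightarrow>
      0 \<le> t \<Longrightarrow> ereal t < T \<Longrightarrow>
      1 + B_int b t \<le> C * (1 + \<epsilon> powr (- inverse (1 / (p - 1) - real CARD('n) / 2 - \<beta>)))"
proof -
  define \<kappa> where "\<kappa> = 1 / (p - 1) - real CARD('n) / 2 - \<beta>"
  have k: "0 < \<kappa>" using \<kappa> by (simp add: \<kappa>_def)
  obtain K R0 where K: "0 < K" "2 \<le> R0"
    "\<And>\<epsilon> T (u :: real \<times> (real ^ 'n) \<Rightarrow> real) R t. 0 < \<epsilon> \<Longrightarrow> weak_solution b m f g p \<epsilon> T u \<Longrightarrow>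
      R0 \<le> R \<Longrightarrow> 0 \<le> t \<Longrightarrow> ereal t < T \<Longrightarrow> R \<le> 1 + B_int b t \<Longrightarrow>
      \<epsilon> \<le> K * R powr (- \<kappa>) * exp (Omega b m \<beta> T0 (ln R))"
    by (rule subcritical_estimate[folded \<kappa>_def], rule that)
  obtain W where W: "\<And>L. 0 \<le> L \<Longrightarrow> Omega b m \<beta> T0 L \<le> W"
    using bdd unfolding bounded_iff by (force simp: abs_le_iff)
  define C1 where "C1 = (K * exp W) powr (1 / \<kappa>)"
  have C1: "0 \<le> C1" by (simp add: C1_def)
  show ?thesis
  proof (rule that[of "R0 + C1"])
    show "0 < R0 + C1" using K(2) C1 by linarith
    fix \<epsilon> T t and u :: "real \<times> (real ^ 'n) \<Rightarrow> real"
    assume e: "0 < \<epsilon>" and u: "weak_solution b m f g p \<epsilon> T u" and t: "0 \<le> t" "ereal t < T"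
    let ?R = "1 + B_int b t" and ?E = "\<epsilon> powr (- inverse \<kappa>)"
    have E0: "0 \<le> ?E" by simp
    have "?R \<le> (R0 + C1) * (1 + ?E)"
    proof (cases "R0 \<le> ?R")
      case False
      have "R0 * 1 \<le> (R0 + C1) * (1 + ?E)" using K(2) C1 E0 by (intro mult_mono) auto
      then show ?thesis using False by linarith
    next
      case True
      have R: "1 \<le> ?R" "0 < ?R" using True K(2) by linarith+
      have "exp (Omega b m \<beta> T0 (ln ?R)) \<le> exp W" using W[of "ln ?R"] R by simp
      then have "K * ?R powr (- \<kappa>) * exp (Omega b m \<beta> T0 (ln ?R)) \<le> K * ?R powr (- \<kappa>) * exp W"
        using K(1) by (intro mult_left_mono) auto
      then have "\<epsilon> \<le> K * ?R powr (- \<kappa>) * exp W" using K(3)[OF e u True t order_refl] by linarith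
      then have "?R powr \<kappa> \<le> K * exp W / \<epsilon>" using e R(2) by (simp add: powr_minus field_simps)
      then have "(?R powr \<kappa>) powr (1 / \<kappa>) \<le> (K * exp W / \<epsilon>) powr (1 / \<kappa>)"
        using k by (intro powr_mono2) auto
      also have "(?R powr \<kappa>) powr (1 / \<kappa>) = ?R" using k R by (simp add: powr_powr)
      also have "(K * exp W / \<epsilon>) powr (1 / \<kappa>) = C1 * ?E"
        using K(1) e by (simp add: C1_def powr_divide powr_minus_divide inverse_eq_divide)
      also have "\<dots> \<le> (R0 + C1) * (1 + ?E)" using K(2) C1 E0 by (intro mult_mono) auto
      finally show ?thesis .
    qed
    then show "?R \<le> (R0 + C1) * (1 + \<epsilon> powr (- inverse (1 / (p - 1) - real CARD('n) / 2 - \<beta>)))"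
      unfolding \<kappa>_def .
  qed
qed

text \<open>With \<open>\<Omega> \<le> W\<close> every summand is at least \<open>q\<close>, so the
  number of radii \<open>R0 * 2 ^ i\<close> reached by \<open>1 + B(t)\<close> is at most
  \<open>K \<epsilon>^(1-p) / q\<close>; exponentiating that number bounds
  \<open>1 + B(t)\<close>.\<close>

lemma lifespan_critical:
  assumes bdd: "bounded (Omega b m \<beta> T0 ` {0..})"
    and crit: "1 / (p - 1) - real CARD('n) / 2 - \<beta> = 0"
  obtains C where "0 < C"
    "\<And>\<epsilon> T (u :: real \<times> (real ^ 'n) \<Rightarrow> real) t. 0 < \<epsilon> \<Longrightarrow> weak_solution b m f g p \<epsilon> T u \<Longrightarrow>
      0 \<le> t \<Longrightarrow> ereal t < T \<Longrightarrow> 1 + B_int b t \<le> C * exp (C * \<epsilon> powr (- (p - 1)))"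
proof -
  obtain K R0 where K: "0 < K" "2 \<le> R0"
    "\<And>\<epsilon> T (u :: real \<times> (real ^ 'n) \<Rightarrow> real) N. 0 < \<epsilon> \<Longrightarrow> weak_solution b m f g p \<epsilon> T u \<Longrightarrow>
      \<forall>i<N. \<exists>t\<ge>0. ereal t < T \<and> R0 * 2 ^ i \<le> 1 + B_int b t \<Longrightarrow>
      (\<Sum>i<N. exp (- (p - 1) * Omega b m \<beta> T0 (ln R0 + real i * ln 2))) \<le> K * \<epsilon> powr (1 - p)"
    by (rule critical_sum_estimate[OF crit], rule that)
  obtain W where W: "\<And>L. 0 \<le> L \<Longrightarrow> Omega b m \<beta> T0 L \<le> W"
    using bdd unfolding bounded_iff by (force simp: abs_le_iff)
  define q where "q = exp (- (p - 1) * W)"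
  have q: "0 < q" by (simp add: q_def)
  define C1 where "C1 = ln 2 * K / q"
  have C1: "0 < C1" using K(1) q by (simp add: C1_def)
  show ?thesis
  proof (rule that[of "R0 + C1"])
    show "0 < R0 + C1" using K(2) C1 by linarith
    fix \<epsilon> T t and u :: "real \<times> (real ^ 'n) \<Rightarrow> real"
    assume e: "0 < \<epsilon>" and u: "weak_solution b m f g p \<epsilon> T u" and t: "0 \<le> t" "ereal t < T"
    let ?R = "1 + B_int b t"
    obtain N0 where "?R / R0 < 2 ^ N0" using real_arch_pow[of 2 "?R / R0"] by auto
    then have ex: "?R < R0 * 2 ^ N0" using K(2) by (simp add: field_simps)
    \<comment> \<open>Minimality makes every \<open>i < N\<close> admissible at the time
      \<open>t\<close> itself. For \<open>1 + B(t) < R0\<close> this gives \<open>N = 0\<close> and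
      an empty sum.\<close>
    define N where "N = (LEAST N. ?R < R0 * 2 ^ N)"
    have N: "?R < R0 * 2 ^ N" unfolding N_def by (rule LeastI[of _ N0]) (rule ex)
    have "(\<Sum>i<N. q) \<le> (\<Sum>i<N. exp (- (p - 1) * Omega b m \<beta> T0 (ln R0 + real i * ln 2)))"
    proof (rule sum_mono)
      fix i
      have "0 \<le> ln R0 + real i * ln 2" using K(2) by simp
      then show "q \<le> exp (- (p - 1) * Omega b m \<beta> T0 (ln R0 + real i * ln 2))"
        using W p by (simp add: q_def mult_left_mono)
    qed
    also have "\<dots> \<le> K * \<epsilon> powr (1 - p)"
    proof (rule K(3)[OF e u], intro allI impI)
      fix i assume "i < N"
      then have "\<not> ?R < R0 * 2 ^ i" unfolding N_def by (rule not_less_Least)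
      then show "\<exists>t\<ge>0. ereal t < T \<and> R0 * 2 ^ i \<le> 1 + B_int b t" using t by (intro exI[of _ t]) auto
    qed
    finally have "real N * q \<le> K * \<epsilon> powr (1 - p)" by simp
    then have "ln 2 * (real N * q) \<le> ln 2 * (K * \<epsilon> powr (1 - p))" by (intro mult_left_mono) auto
    then have "real N * ln 2 \<le> C1 * \<epsilon> powr (- (p - 1))"
      using q by (simp add: C1_def field_simps)
    also have "\<dots> \<le> (R0 + C1) * \<epsilon> powr (- (p - 1))" using K(2) by (intro mult_right_mono) auto
    finally have "exp (real N * ln 2) \<le> exp ((R0 + C1) * \<epsilon> powr (- (p - 1)))" by simp
    moreover have "exp (real N * ln 2) = 2 ^ N" by (simp add: exp_of_nat_mult)
    ultimately have "R0 * 2 ^ N \<le> (R0 + C1) * exp ((R0 + C1) * \<epsilon> powr (- (p - 1)))"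
      using K(2) C1 by (intro mult_mono) auto
    then show "?R \<le> (R0 + C1) * exp ((R0 + C1) * \<epsilon> powr (- (p - 1)))" using N by linarith
  qed
qed

text \<open>Solutions are given on \<open>[0,T')\<close> with \<open>T' < T\<close>; each
  \<open>t < T\<close> lies below such a \<open>T'\<close>, and \<open>B_ext_le\<close> passes the
  pointwise bound to \<open>T\<close>. The sign of \<open>\<kappa>\<close> decides which implication
  has content.\<close>

lemma lifespan:
  assumes bdd: "bounded (Omega b m \<beta> T0 ` {0..})"
  obtains C where "0 < C"
    "\<And>\<epsilon> T (u :: real \<times> (real ^ 'n) \<Rightarrow> real). 0 < \<epsilon> \<Longrightarrow> 0 < T \<Longrightarrow>
      \<forall>T'. 0 < T' \<and> T' < T \<longrightarrow> weak_solution b m f g p \<epsilon> T' u \<Longrightarrow>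
      (p < p_crit CARD('n) \<beta> \<longrightarrow> 1 + B_ext b T
         \<le> ereal (C * (1 + \<epsilon> powr (- inverse (1 / (p - 1) - real CARD('n) / 2 - \<beta>))))) \<and>
      (p = p_crit CARD('n) \<beta> \<longrightarrow> 1 + B_ext b T \<le> ereal (C * exp (C * \<epsilon> powr (- (p - 1)))))"
proof -
  let ?\<kappa> = "1 / (p - 1) - real CARD('n) / 2 - \<beta>"
  have "0 \<le> \<beta>" using mb by (simp add: mass_balance_def)
  note pc = p_crit_iff[OF p this zero_less_card_finite[where 'a = 'n]]
  have ext: "1 + B_ext b T \<le> ereal c"
    if "0 < T" and w: "\<forall>T'. 0 < T' \<and> T' < T \<longrightarrow> weak_solution b m f g p \<epsilon> T' u"
      and c: "\<And>T' t. weak_solution b m f g p \<epsilon> T' u \<Longrightarrow> 0 \<le> t \<Longrightarrow> ereal t < T' \<Longrightarrow> 1 + B_int b t \<le> c"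
    for \<epsilon> T c and u :: "real \<times> (real ^ 'n) \<Rightarrow> real"
  proof (rule B_ext_le[OF b \<open>0 < T\<close>])
    fix t assume t: "0 \<le> t" "ereal t < T"
    obtain T' where T': "ereal t < T'" "T' < T" using dense[OF t(2)] by blast
    have "0 < T'" using t(1) T'(1) by (auto simp: zero_ereal_def intro: le_less_trans[of _ "ereal t"])
    then show "1 + B_int b t \<le> c" using w T' t by (intro c[of T']) auto
  qed
  let ?concl = "\<lambda>C \<epsilon> T. (p < p_crit CARD('n) \<beta> \<longrightarrow> 1 + B_ext b T
         \<le> ereal (C * (1 + \<epsilon> powr (- inverse ?\<kappa>)))) \<and>
      (p = p_crit CARD('n) \<beta> \<longrightarrow> 1 + B_ext b T \<le> ereal (C * exp (C * \<epsilon> powr (- (p - 1)))))"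
  consider "0 < ?\<kappa>" | "?\<kappa> = 0" | "?\<kappa> < 0" by linarith
  then show ?thesis
  proof cases
    case 1
    obtain C where C: "0 < C" "\<And>\<epsilon> T (u :: real \<times> (real ^ 'n) \<Rightarrow> real) t. 0 < \<epsilon> \<Longrightarrow>
      weak_solution b m f g p \<epsilon> T u \<Longrightarrow> 0 \<le> t \<Longrightarrow> ereal t < T \<Longrightarrow>
      1 + B_int b t \<le> C * (1 + \<epsilon> powr (- inverse ?\<kappa>))"
      by (rule lifespan_subcritical[OF bdd 1]) (rule that)
    show ?thesis
    proof (rule that[OF C(1)])
      fix \<epsilon> T and u :: "real \<times> (real ^ 'n) \<Rightarrow> real"
      assume "0 < \<epsilon>" "0 < T" "\<forall>T'. 0 < T' \<and> T' < T \<longrightarrow> weak_solution b m f g p \<epsilon> T' u"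
      then have "1 + B_ext b T \<le> ereal (C * (1 + \<epsilon> powr (- inverse ?\<kappa>)))"
        by (intro ext[of T \<epsilon> u] C(2)[of \<epsilon> _ u])
      moreover have "p \<noteq> p_crit CARD('n) \<beta>" using 1 pc(2) by linarith
      ultimately show "?concl C \<epsilon> T" by blast
    qed
  next
    case 2
    obtain C where C: "0 < C" "\<And>\<epsilon> T (u :: real \<times> (real ^ 'n) \<Rightarrow> real) t. 0 < \<epsilon> \<Longrightarrow>
      weak_solution b m f g p \<epsilon> T u \<Longrightarrow> 0 \<le> t \<Longrightarrow> ereal t < T \<Longrightarrow>
      1 + B_int b t \<le> C * exp (C * \<epsilon> powr (- (p - 1)))"
      by (rule lifespan_critical[OF bdd 2]) (rule that)
    show ?thesis
    proof (rule that[OF C(1)])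
      fix \<epsilon> T and u :: "real \<times> (real ^ 'n) \<Rightarrow> real"
      assume "0 < \<epsilon>" "0 < T" "\<forall>T'. 0 < T' \<and> T' < T \<longrightarrow> weak_solution b m f g p \<epsilon> T' u"
      then have "1 + B_ext b T \<le> ereal (C * exp (C * \<epsilon> powr (- (p - 1))))"
        by (intro ext[of T \<epsilon> u] C(2)[of \<epsilon> _ u])
      moreover have "\<not> p < p_crit CARD('n) \<beta>" using 2 pc(1) by linarith
      ultimately show "?concl C \<epsilon> T" by blast
    qed
  next
    case 3
    then have "\<not> p < p_crit CARD('n) \<beta>" "p \<noteq> p_crit CARD('n) \<beta>" using pc by linarith+
    \<comment> \<open>For supercritical \<open>p\<close> both implications are vacuous, so any
      positive constant will do.\<close>
    then show ?thesis by (intro that[of 1]) auto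
  qed
qed

end

text \<open>\<open>p_crit_iff\<close> translates the ranges of \<open>p\<close> into the sign of
  \<open>\<kappa>\<close>. In the lifespan part \<open>C\<close> is chosen before the solution
  class, the threshold \<open>\<epsilon>0\<close> and the family of solutions, so it depends on none
  of them.\<close>

theorem corollary20:
  fixes b m \<rho> :: "real \<Rightarrow> real"
    and \<beta> T0 p :: real
    and f g :: "real ^ 'n \<Rightarrow> real"
  assumes "p > 1"
    and "effective_damping b"
    and "dominated_mass b m"
    and "mass_balance b m \<beta> T0"
    and "liouville_nonoscillation b m"
    and "slow_adjoint_solution b m \<beta> T0 \<rho>"
    and "integrable lebesgue f"
    and "integrable lebesgue g"
    and "J0 b \<rho> f g > 0"
  shows
    "(((\<lambda>L. Omega b m \<beta> T0 L / L) \<longlongrightarrow> 0) at_top \<longrightarrow> p < p_crit CARD('n) \<beta> \<longrightarrow>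
       (\<forall>\<epsilon>>0. \<not> (\<exists>u. global_weak_solution b m f g p \<epsilon> u))) \<and>
     (p = p_crit CARD('n) \<beta> \<longrightarrow>
       (\<integral>\<^sup>+ L \<in> {0..}. ennreal (exp (- (p_crit CARD('n) \<beta> - 1) * Omega b m \<beta> T0 L)) \<partial>lborel) = \<infinity> \<longrightarrow>
       (\<forall>\<epsilon>>0. \<not> (\<exists>u. global_weak_solution b m f g p \<epsilon> u))) \<and>
     (bounded (Omega b m \<beta> T0 ` {0..}) \<longrightarrow>
       (\<exists>C>0. \<forall>(Sol :: real \<Rightarrow> ereal \<Rightarrow> (real \<times> (real ^ 'n) \<Rightarrow> real) \<Rightarrow> bool) \<epsilon>0 u T_max.
          \<epsilon>0 > 0 \<longrightarrow>
          (\<forall>\<epsilon>\<in>{0<..<\<epsilon>0}.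
             maximal_solution (Sol \<epsilon>) (T_max \<epsilon>) (u \<epsilon>) \<and>
             (\<forall>T. 0 < T \<and> T < T_max \<epsilon> \<longrightarrow> weak_solution b m f g p \<epsilon> T (u \<epsilon>))) \<longrightarrow>
          (\<forall>\<epsilon>\<in>{0<..<\<epsilon>0}.
             (p < p_crit CARD('n) \<beta> \<longrightarrow>
                1 + B_ext b (T_max \<epsilon>)
                \<le> ereal (C * (1 + \<epsilon> powr (- inverse (1 / (p - 1) - real CARD('n) / 2 - \<beta>))))) \<and>
             (p = p_crit CARD('n) \<beta> \<longrightarrow>
                1 + B_ext b (T_max \<epsilon>) \<le> ereal (C * exp (C * \<epsilon> powr (- (p - 1))))))))"
proof -
  note ctx = assms(1,2,4,6-9)
  have "0 \<le> \<beta>" using assms(4) by (simp add: mass_balance_def)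
  note pc = p_crit_iff[OF assms(1) this zero_less_card_finite[where 'a = 'n]]
  show ?thesis
  proof (intro conjI impI allI)
    fix \<epsilon> :: real assume "((\<lambda>L. Omega b m \<beta> T0 L / L) \<longlongrightarrow> 0) at_top" "p < p_crit CARD('n) \<beta>" "0 < \<epsilon>"
    then show "\<not> (\<exists>u. global_weak_solution b m f g p \<epsilon> u)"
      using no_global_solution_subcritical[OF ctx] pc(1) by blast
  next
    fix \<epsilon> :: real assume crit: "p = p_crit CARD('n) \<beta>"
      and "(\<integral>\<^sup>+ L \<in> {0..}. ennreal (exp (- (p_crit CARD('n) \<beta> - 1) * Omega b m \<beta> T0 L)) \<partial>lborel) = \<infinity>" "0 < \<epsilon>"
    then show "\<not> (\<exists>u. global_weak_solution b m f g p \<epsilon> u)"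
      using no_global_solution_critical[OF ctx] pc(2) unfolding crit[symmetric] by blast
  next
    assume bdd: "bounded (Omega b m \<beta> T0 ` {0..})"
    obtain C where "0 < C" and C:
      "\<And>\<epsilon> T (u :: real \<times> (real ^ 'n) \<Rightarrow> real). 0 < \<epsilon> \<Longrightarrow> 0 < T \<Longrightarrow>
      \<forall>T'. 0 < T' \<and> T' < T \<longrightarrow> weak_solution b m f g p \<epsilon> T' u \<Longrightarrow>
      (p < p_crit CARD('n) \<beta> \<longrightarrow> 1 + B_ext b T
         \<le> ereal (C * (1 + \<epsilon> powr (- inverse (1 / (p - 1) - real CARD('n) / 2 - \<beta>))))) \<and>
      (p = p_crit CARD('n) \<beta> \<longrightarrow> 1 + B_ext b T \<le> ereal (C * exp (C * \<epsilon> powr (- (p - 1)))))"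
      by (rule lifespan[OF ctx bdd]) (rule that)
    show "\<exists>C>0. \<forall>(Sol :: real \<Rightarrow> ereal \<Rightarrow> (real \<times> (real ^ 'n) \<Rightarrow> real) \<Rightarrow> bool) \<epsilon>0 u T_max.
          \<epsilon>0 > 0 \<longrightarrow>
          (\<forall>\<epsilon>\<in>{0<..<\<epsilon>0}.
             maximal_solution (Sol \<epsilon>) (T_max \<epsilon>) (u \<epsilon>) \<and>
             (\<forall>T. 0 < T \<and> T < T_max \<epsilon> \<longrightarrow> weak_solution b m f g p \<epsilon> T (u \<epsilon>))) \<longrightarrow>
          (\<forall>\<epsilon>\<in>{0<..<\<epsilon>0}.
             (p < p_crit CARD('n) \<beta> \<longrightarrow>
                1 + B_ext b (T_max \<epsilon>)
                \<le> ereal (C * (1 + \<epsilon> powr (- inverse (1 / (p - 1) - real CARD('n) / 2 - \<beta>))))) \<and>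
             (p = p_crit CARD('n) \<beta> \<longrightarrow>
                1 + B_ext b (T_max \<epsilon>) \<le> ereal (C * exp (C * \<epsilon> powr (- (p - 1))))))"
    proof (intro exI[of _ C] conjI[OF \<open>0 < C\<close>] allI impI ballI)
      fix Sol :: "real \<Rightarrow> ereal \<Rightarrow> (real \<times> (real ^ 'n) \<Rightarrow> real) \<Rightarrow> bool"
        and \<epsilon>0 \<epsilon> :: real and u :: "real \<Rightarrow> real \<times> (real ^ 'n) \<Rightarrow> real" and T_max
      assume e: "\<epsilon> \<in> {0<..<\<epsilon>0}" and max: "\<forall>\<epsilon>\<in>{0<..<\<epsilon>0}.
             maximal_solution (Sol \<epsilon>) (T_max \<epsilon>) (u \<epsilon>) \<and>
             (\<forall>T. 0 < T \<and> T < T_max \<epsilon> \<longrightarrow> weak_solution b m f g p \<epsilon> T (u \<epsilon>))"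
      have "0 < T_max \<epsilon>" using max e by (auto simp: maximal_solution_def)
      then show "(p < p_crit CARD('n) \<beta> \<longrightarrow>
                1 + B_ext b (T_max \<epsilon>)
                \<le> ereal (C * (1 + \<epsilon> powr (- inverse (1 / (p - 1) - real CARD('n) / 2 - \<beta>))))) \<and>
             (p = p_crit CARD('n) \<beta> \<longrightarrow>
                1 + B_ext b (T_max \<epsilon>) \<le> ereal (C * exp (C * \<epsilon> powr (- (p - 1)))))"
        by (rule C[rotated]) (use e max in auto)
    qed
  qed
qed

end
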